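(* Let $n\in\mathbb N$, let $\mu_1,\dots,\mu_n\in\mathcal M$ each have a continuous distribution function and a continuous quantile function, fix $t\in[0,1)$, and let $x=D_n^{-1}(1-t)$. Then $$\inf_{\boldsymbol\beta\in(1-t)\Delta_n}\ \sum_{i=1}^nR_{\beta_i,\beta_0}(\mu_i)=D_n^{-1}(1-t)=x .$$ Moreover, the correspondence between the minimizers $\boldsymbol\beta\in(1-t)\overline\Delta_n$ of the left-hand side and the minimizers $\mathbf r$, in the closure of $\Delta_n(x)$, of the infimum defining $D_n(x)$ is given by $$\mu_i(-\infty,r_i]=1-\beta_0-\beta_i,\qquad \mu_i(-\infty,x-r+r_i]=1-\beta_i,\qquad i=1,\dots,n,$$ where $r=\sum_{i=1}^nr_i$.
   Context: $\mathcal M$ is the set of Borel probability measures on $\mathbb R$. $q^-_t(\mu)=\inf\{x\in\mathbb R:\mu(-\infty,x]\ge t\}$ for $t\in(0,1]$ and $q^+_t(\mu)=\inf\{x\in\mathbb R:\mu(-\infty,x]>t\}$ for $t\in[0,1)$. For $0\le\beta<\beta+\alpha\le1$, $R_{\beta,\alpha}(\mu)=\frac1\alpha\int_\beta^{\beta+\alpha}q^+_{1-u}(\mu)\,du$, with values in $[-\infty,\infty]$; $R_{0,1}$ is the mean and is used only for measures with finite mean. $\Delta_n$ is the set of $\boldsymbol\beta=(\beta_0,\beta_1,\dots,\beta_n)\in[0,1]^{n+1}$ with $\sum_{i=0}^n\beta_i=1$ and $\beta_0>0$; $\overline\Delta_n$ is its closure (the standard simplex), and $c\Delta_n=\{c\boldsymbol\beta:\boldsymbol\beta\in\Delta_n\}$.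 The infimum is over those $\boldsymbol\beta$ for which the sum is well defined (no $\infty-\infty$). For boundary points with $\beta_0=0$, the objective $\sum_{i=1}^nR_{\beta_i,\beta_0}(\mu_i)$ is understood as $\sum_{i=1}^nq^-_{1-\beta_i}(\mu_i)$. For $x\in\mathbb R$, $\Delta_n(x)=\{(r_1,\dots,r_n)\in\mathbb R^n:\sum_{i=1}^nr_i<x\}$, and, writing $\mathbf r=(r_1,\dots,r_n)$ and $r=\sum_{i=1}^nr_i$, $$D_n(x)=\inf_{\mathbf r\in\Delta_n(x)}\ \sum_{i=1}^n\frac1{x-r}\int_{r_i}^{x-r+r_i}\mu_i(y,\infty)\,dy,\qquad D_n^{-1}(\alpha)=\inf\{x\in\mathbb R:D_n(x)<\alpha\},\ \alpha\in(0,1].$$ For boundary points with $r=x$, the objective in $D_n(x)$ is understood as its limit $\sum_{i=1}^n\mu_i(r_i,\infty)$.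
   Formalization: For t=0 the correspondence is claimed only if x is real, for minimizers β whose equations μ_i(-∞,r_i]=1-β_0-β_i are solvable, and for r whose β has all β_i<1; without this it fails (two standard normals, β=(1,0,0); three uniforms on [0,1], r=(-10,2,2)). *)

theory Defs
  imports "HOL-Probability.Probability"
begin

text \<open>Both quantiles are taken in the extended reals: the left quantile at level 1 may be
  \<open>\<infinity>\<close> and the right quantile at level 0 may be \<open>-\<infinity>\<close>.  They are meaningful for levels in
  \<open>(0,1]\<close> and \<open>[0,1)\<close>, respectively.\<close>

definition qminus :: "real measure \<Rightarrow> real \<Rightarrow> ereal" where
  "qminus M t = (INF y\<in>{y. cdf M y \<ge> t}. ereal y)"

definition qplus :: "real measure \<Rightarrow> real \<Rightarrow> ereal" where
  "qplus M t = (INF y\<in>{y. cdf M y > t}. ereal y)"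

text \<open>The average quantile \<open>R\<^sub>b\<^sub>,\<^sub>a\<close> for \<open>0 \<le> b < b + a \<le> 1\<close>, as the Lebesgue integral of the
  positive part minus that of the negative part.  Over the open interval, the quantile is taken
  at levels in \<open>(0,1)\<close> only, where it is finite.  At most one of the two integrals is infinite
  unless \<open>b = 0\<close> and \<open>a = 1\<close>, a case that is used only for measures with finite mean.\<close>

definition rvar :: "real \<Rightarrow> real \<Rightarrow> real measure \<Rightarrow> ereal" where
  "rvar b a M = ereal (1 / a) *
     (enn2ereal (\<integral>\<^sup>+u\<in>{b<..<b+a}. e2ennreal (qplus M (1 - u)) \<partial>lborel)
      - enn2ereal (\<integral>\<^sup>+u\<in>{b<..<b+a}. e2ennreal (- qplus M (1 - u)) \<partial>lborel))"

text \<open>A point \<open>(\<beta>\<^sub>0, \<beta>\<^sub>1, \<dots>, \<beta>\<^sub>n)\<close> is a pair of the number \<open>\<beta>\<^sub>0\<close> and the vector of the others.\<close>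

definition Delta :: "(real \<times> (real ^ 'n::finite)) set" where
  "Delta = {\<beta>. 0 < fst \<beta> \<and> fst \<beta> \<le> 1 \<and> (\<forall>i. 0 \<le> snd \<beta> $ i \<and> snd \<beta> $ i \<le> 1)
                \<and> fst \<beta> + (\<Sum>i\<in>UNIV. snd \<beta> $ i) = 1}"

definition scaled_Delta :: "real \<Rightarrow> (real \<times> (real ^ 'n::finite)) set" where
  "scaled_Delta c = (\<lambda>\<beta>. c *\<^sub>R \<beta>) ` Delta"

definition scaled_closed_Delta :: "real \<Rightarrow> (real \<times> (real ^ 'n::finite)) set" where
  "scaled_closed_Delta c = (\<lambda>\<beta>. c *\<^sub>R \<beta>) ` closure Delta"

definition conv_term ::
    "('n::finite \<Rightarrow> real measure) \<Rightarrow> (real \<times> (real ^ 'n)) \<Rightarrow> 'n \<Rightarrow> ereal" where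
  "conv_term \<mu> \<beta> i =
     (if fst \<beta> = 0 then qminus (\<mu> i) (1 - snd \<beta> $ i) else rvar (snd \<beta> $ i) (fst \<beta>) (\<mu> i))"

definition conv_obj ::
    "('n::finite \<Rightarrow> real measure) \<Rightarrow> (real \<times> (real ^ 'n)) \<Rightarrow> ereal" where
  "conv_obj \<mu> \<beta> = (\<Sum>i\<in>UNIV. conv_term \<mu> \<beta> i)"

text \<open>The objective is well defined if each summand is defined (the left quantile has no value at
  level 0, and \<open>R\<^sub>0\<^sub>,\<^sub>1\<close> requires a finite mean) and no \<open>\<infinity> - \<infinity>\<close> occurs.  On the simplex,
  \<open>\<beta>\<^sub>0 = 1\<close> forces all other coordinates to be 0.\<close>

definition conv_defined ::
    "('n::finite \<Rightarrow> real measure) \<Rightarrow> (real \<times> (real ^ 'n)) \<Rightarrow> bool" where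
  "conv_defined \<mu> \<beta> \<longleftrightarrow>
     (fst \<beta> = 0 \<longrightarrow> (\<forall>i. 0 < 1 - snd \<beta> $ i)) \<and>
     (fst \<beta> = 1 \<longrightarrow> (\<forall>i. integrable (\<mu> i) (\<lambda>y. y))) \<and>
     \<not> (\<exists>i j. conv_term \<mu> \<beta> i = \<infinity> \<and> conv_term \<mu> \<beta> j = -\<infinity>)"

definition conv_inf :: "('n::finite \<Rightarrow> real measure) \<Rightarrow> real \<Rightarrow> ereal" where
  "conv_inf \<mu> t = (INF \<beta>\<in>{\<beta>\<in>scaled_Delta (1 - t). conv_defined \<mu> \<beta>}. conv_obj \<mu> \<beta>)"

definition conv_minimizers ::
    "('n::finite \<Rightarrow> real measure) \<Rightarrow> real \<Rightarrow> (real \<times> (real ^ 'n)) set" where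
  "conv_minimizers \<mu> t =
     {\<beta>\<in>scaled_closed_Delta (1 - t). conv_defined \<mu> \<beta> \<and> conv_obj \<mu> \<beta> = conv_inf \<mu> t}"

definition Delta_below :: "real \<Rightarrow> (real ^ 'n::finite) set" where
  "Delta_below x = {r. (\<Sum>i\<in>UNIV. r $ i) < x}"

definition dual_obj :: "('n::finite \<Rightarrow> real measure) \<Rightarrow> real \<Rightarrow> real ^ 'n \<Rightarrow> real" where
  "dual_obj \<mu> x r =
     (let s = (\<Sum>i\<in>UNIV. r $ i) in
      if s = x then (\<Sum>i\<in>UNIV. measure (\<mu> i) {r $ i<..})
      else (\<Sum>i\<in>UNIV. 1 / (x - s) *
              (LINT y:{r $ i..x - s + r $ i}|lborel. measure (\<mu> i) {y<..})))"

definition dual_bound :: "('n::finite \<Rightarrow> real measure) \<Rightarrow> real \<Rightarrow> real" where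
  "dual_bound \<mu> x = (INF r\<in>Delta_below x. dual_obj \<mu> x r)"

definition dual_bound_inv :: "('n::finite \<Rightarrow> real measure) \<Rightarrow> real \<Rightarrow> ereal" where
  "dual_bound_inv \<mu> a = (INF x\<in>{x. dual_bound \<mu> x < a}. ereal x)"

definition dual_minimizers ::
    "('n::finite \<Rightarrow> real measure) \<Rightarrow> real \<Rightarrow> (real ^ 'n) set" where
  "dual_minimizers \<mu> x = {r\<in>closure (Delta_below x). dual_obj \<mu> x r = dual_bound \<mu> x}"

definition corresponds ::
    "('n::finite \<Rightarrow> real measure) \<Rightarrow> real \<Rightarrow> (real \<times> (real ^ 'n)) \<Rightarrow> real ^ 'n \<Rightarrow> bool" where
  "corresponds \<mu> x \<beta> r \<longleftrightarrow>
     (let s = (\<Sum>i\<in>UNIV. r $ i) in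
      \<forall>i. measure (\<mu> i) {..r $ i} = 1 - fst \<beta> - snd \<beta> $ i \<and>
          measure (\<mu> i) {..x - s + r $ i} = 1 - snd \<beta> $ i)"

end

theory Submission
  imports Defs
begin

text \<open>Write \<open>F\<^sub>i\<close> for the distribution functions and, for a level interval \<open>(\<beta>, \<beta> + a)\<close> and points \<open>r \<le> b\<close>, put
  \<open>G\<^sub>i(r, b) = \<integral>\<^sub>r\<^sup>b (1 - F\<^sub>i) + r (\<beta> + a) - b \<beta>\<close>.  Since \<open>\<integral>\<^sub>r\<^sup>b (1 - F\<^sub>i)\<close> is the integral over \<open>(0,1)\<close>
  of the quantile function clipped to \<open>[r, b]\<close> minus \<open>r\<close>, a pointwise comparison shows that \<open>a R\<^sub>\<beta>\<^sub>,\<^sub>a\<close> is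
  the saddle value of \<open>G\<^sub>i\<close>: it is at most \<open>G\<^sub>i(r, b)\<close> if \<open>F\<^sub>i(b) = 1 - \<beta>\<close>, and at least \<open>G\<^sub>i(r, b)\<close> if
  \<open>F\<^sub>i(r) = 1 - \<beta> - a\<close>.  For points with \<open>b\<^sub>i - r\<^sub>i = x - \<Sum> r\<^sub>j =: d\<close> and \<open>\<beta>\<^sub>0 + \<Sum> \<beta>\<^sub>i = c\<close> the sum of the
  \<open>G\<^sub>i\<close> is \<open>\<beta>\<^sub>0 x + d (K - c)\<close>, where \<open>K\<close> is the objective of \<open>D\<^sub>n(x)\<close> at \<open>r\<close>.  Choosing \<open>\<beta>\<close> from \<open>r\<close> through
  \<open>F\<^sub>i(r\<^sub>i + d) = 1 - \<beta>\<^sub>i\<close>, or \<open>r\<close> from \<open>\<beta>\<close> through \<open>F\<^sub>i(r\<^sub>i) = 1 - \<beta>\<^sub>0 - \<beta>\<^sub>i\<close>, gives the two inequalities.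
  Uniform continuity of the \<open>F\<^sub>i\<close> makes \<open>D\<^sub>n\<close> continuous, so that \<open>D\<^sub>n = c\<close> at the inverse; for minimizers
  all inequalities are equalities, and the correspondence is read off from the first-order conditions.\<close>

section \<open>Average quantiles of one distribution\<close>

lemma ereal_integral_eq_nn_integral_diff:
  assumes "integrable M (f :: _ \<Rightarrow> real)"
  shows "ereal (integral\<^sup>L M f)
    = enn2ereal (\<integral>\<^sup>+x. ennreal (f x) \<partial>M) - enn2ereal (\<integral>\<^sup>+x. ennreal (- f x) \<partial>M)"
  by (rule integrableE[OF assms]) (simp add: enn2ereal_ennreal)

text \<open>Subtraction of extended reals is monotone even at infinite values, so a possibly
  infinite average quantile can be compared pointwise with an integrable clipped function.\<close>

lemma nn_integral_diff_mono:
  assumes "\<And>x. f x \<le> (g x :: real)"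
  shows "enn2ereal (\<integral>\<^sup>+x. ennreal (f x) \<partial>M) - enn2ereal (\<integral>\<^sup>+x. ennreal (- f x) \<partial>M)
    \<le> enn2ereal (\<integral>\<^sup>+x. ennreal (g x) \<partial>M) - enn2ereal (\<integral>\<^sup>+x. ennreal (- g x) \<partial>M)"
  by (intro ereal_minus_mono; simp add: less_eq_ennreal.rep_eq[symmetric])
     (auto intro!: nn_integral_mono ennreal_leI assms)

section \<open>Distribution and quantile functions without jumps or flat pieces\<close>

locale continuous_quantile_distribution = cdf_distribution +
  assumes continuous_cdf: "continuous_on UNIV (cdf M)"
    and continuous_quantile: "continuous_on {0<..1} (qminus M)"
begin

text \<open>Right-continuity carries the bound from all points to the right of x to x itself. This
  Galois connection is kept in the extended reals so that it covers level 1, where the quantile may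
  be infinite.\<close>

lemma qminus_le_iff:
  assumes "0 < v"
  shows "qminus M v \<le> ereal x \<longleftrightarrow> v \<le> C x"
proof
  assume le: "qminus M v \<le> ereal x"
  have "C y \<ge> v" if "y > x" for y
  proof -
    have "qminus M v < ereal y" using le that by (meson ereal_less_eq(3) less_ereal.simps(1) order.strict_trans1)
    then obtain z where "C z \<ge> v" "z < y" unfolding qminus_def INF_less_iff by auto
    then show ?thesis using cdf_nondecreasing[of z y] by linarith
  qed
  then have "eventually (\<lambda>y. v \<le> C y) (at_right x)"
    by (simp add: eventually_at_right_less eventually_mono[OF eventually_at_right_less])
  moreover have "(C \<longlongrightarrow> C x) (at_right x)"
    using cdf_is_right_cont[of x] by (simp add: continuous_within)
  ultimately show "v \<le> C x" by (auto intro: tendsto_lowerbound)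
next
  assume "v \<le> C x"
  then show "qminus M v \<le> ereal x" unfolding qminus_def by (intro INF_lower) auto
qed

lemma qminus_neq_MInf:
  assumes "0 < v"
  shows "qminus M v \<noteq> -\<infinity>"
proof
  assume a: "qminus M v = -\<infinity>"
  have "eventually (\<lambda>x. C x < v) at_bot" using cdf_lim_at_bot assms by (rule order_tendstoD)
  then obtain x where "C x < v" by (meson eventually_happens' trivial_limit_at_bot_linorder)
  then show False using qminus_le_iff[OF assms, of x] a by simp
qed

lemma qminus_eq_quantile:
  assumes "0 < v" "v < 1"
  shows "qminus M v = ereal (I v)"
proof (rule antisym)
  show "qminus M v \<le> ereal (I v)" using assms by (simp add: qminus_le_iff pseudoinverse[OF assms, of "I v"])
  show "ereal (I v) \<le> qminus M v" unfolding qminus_def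
    by (intro INF_greatest) (auto simp flip: pseudoinverse[OF assms])
qed

lemma isCont_cdf_all: "isCont C x"
  using continuous_cdf by (simp add: continuous_on_eq_continuous_at)

text \<open>A value of \<open>C\<close> above v at y would, by left-continuity, persist slightly to
  the left of y and make the quantile smaller.\<close>

lemma cdf_of_qminus:
  assumes "qminus M v = ereal y" "0 < v" "v \<le> 1"
  shows "C y = v"
proof (rule antisym)
  show "v \<le> C y" using qminus_le_iff[of v y] assms by simp
  show "C y \<le> v"
  proof (rule ccontr)
    assume "\<not> C y \<le> v"
    then have "eventually (\<lambda>z. v < C z) (at_left y)"
      using isCont_cdf_all[of y] by (intro order_tendstoD) (auto simp: isCont_def filterlim_at_split)
    moreover have "eventually (\<lambda>z. z < y) (at_left y)" by (simp add: eventually_at_filter)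
    ultimately obtain z where "v < C z" "z < y"
      by (metis (mono_tags, lifting) eventually_conj eventually_happens' trivial_limit_at_left_real)
    then show False using qminus_le_iff[of v z] assms by simp
  qed
qed

lemma cdf_quantile: "0 < v \<Longrightarrow> v < 1 \<Longrightarrow> C (I v) = v"
  using cdf_of_qminus[of v "I v"] qminus_eq_quantile[of v] by simp

text \<open>A flat piece of the distribution function at a level in \<open>(0,1)\<close> would be a jump of the
  quantile function.\<close>

lemma cdf_strict:
  assumes "x < y" "0 < C x" "C x < 1"
  shows "C x < C y"
proof (rule ccontr)
  assume "\<not> C x < C y"
  then have eq: "C y = C x" using cdf_nondecreasing[of x y] assms by simp
  let ?v = "C x"
  have le: "qminus M ?v \<le> ereal x" using qminus_le_iff assms by simp
  have ge: "ereal y \<le> qminus M w" if "?v < w" for w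
  proof (rule ccontr)
    assume "\<not> ereal y \<le> qminus M w"
    then have "qminus M w \<le> ereal y" by simp
    then show False using qminus_le_iff[of w y] that eq assms by simp
  qed
  have "(qminus M \<longlongrightarrow> qminus M ?v) (at ?v within {0<..1})"
    using continuous_quantile assms by (auto simp: continuous_on_def)
  then have "(qminus M \<longlongrightarrow> qminus M ?v) (at ?v within {?v..1})"
    by (rule tendsto_within_subset) (use assms in auto)
  then have "(qminus M \<longlongrightarrow> qminus M ?v) (at_right ?v)"
    using at_within_Icc_at_right[OF assms(3)] by simp
  moreover have "eventually (\<lambda>w. ereal y \<le> qminus M w) (at_right ?v)"
    using ge by (auto simp: eventually_at_filter)
  ultimately have "ereal y \<le> qminus M ?v" by (rule tendsto_lowerbound) simp
  then show False using le assms(1)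
    by (metis ereal_less_eq(3) linorder_not_less order_trans)
qed

lemma cdf_inj:
  assumes "C x = C y" "0 < C x" "C x < 1"
  shows "x = y"
  using cdf_strict[of x y] cdf_strict[of y x] assms by (cases x y rule: linorder_cases) auto

text \<open>By \<open>cdf_strict\<close> the level v is exceeded immediately to the right of the
  left quantile, so the left and the right quantile agree inside (0,1).\<close>

lemma qplus_eq_quantile:
  assumes "0 < v" "v < 1"
  shows "qplus M v = ereal (I v)"
proof (rule antisym)
  show "ereal (I v) \<le> qplus M v" unfolding qplus_def
    by (intro INF_greatest) (auto simp flip: pseudoinverse[OF assms])
  show "qplus M v \<le> ereal (I v)"
  proof (rule ereal_le_epsilon2)
    fix e :: real assume "0 < e"
    then have "C (I v + e) > v" using cdf_strict[of "I v" "I v + e"] cdf_quantile assms by simp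
    then have "qplus M v \<le> ereal (I v + e)" unfolding qplus_def by (intro INF_lower) auto
    then show "qplus M v \<le> ereal (I v) + ereal e" by simp
  qed
qed

section \<open>Tail quantiles, clipping and the saddle function\<close>

lemma measure_greaterThan: "measure M {y<..} = 1 - C y"
proof -
  have "{y<..} = space M - {..y}" by auto
  then show ?thesis using prob_compl[of "{..y}"] unfolding cdf_def2 by simp
qed

text \<open>The decreasing parametrization of the quantile that occurs in \<open>rvar\<close>. The
  default 0 outside (0,1) gives a real-valued function on the whole line.\<close>

definition tail_quantile :: "real \<Rightarrow> real" where
  "tail_quantile u = (if u \<in> {0<..<1} then I (1 - u) else 0)"

lemma measurable_tail_quantile[measurable]: "tail_quantile \<in> borel_measurable borel"
proof -
  have 1: "(\<lambda>u. 1 - u :: real) \<in> measurable (restrict_space borel {0<..<1}) (restrict_space borel {0<..<1})"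
    by (intro measurable_restrict_space2) (auto simp: space_restrict_space intro: measurable_restrict_space1)
  have 2: "(\<lambda>u. I (1 - u)) \<in> borel_measurable (restrict_space borel {0<..<1})"
    using measurable_compose[OF 1 measurable_CI] by simp
  have Collect_Ioo: "{x::real. 0 < x \<and> x < 1} = {0<..<1}" by auto
  have "(\<lambda>u. if u \<in> {0<..<1} then I (1 - u) else 0) \<in> borel_measurable borel"
    using 2 by (subst measurable_If_restrict_space_iff) (auto simp: Collect_Ioo)
  then show ?thesis unfolding tail_quantile_def[abs_def] .
qed

lemma tail_quantile_le_iff:
  assumes "0 < u" "u < 1"
  shows "tail_quantile u \<le> y \<longleftrightarrow> 1 - u \<le> C y"
  using pseudoinverse[of "1 - u" y] assms unfolding tail_quantile_def by simp

lemma rvar_eq: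
  assumes "0 \<le> \<beta>" "0 < a" "\<beta> + a \<le> 1"
  shows "rvar \<beta> a M = ereal (1 / a) *
     (enn2ereal (\<integral>\<^sup>+u. ennreal (indicator {\<beta><..<\<beta>+a} u * tail_quantile u) \<partial>lborel)
      - enn2ereal (\<integral>\<^sup>+u. ennreal (- (indicator {\<beta><..<\<beta>+a} u * tail_quantile u)) \<partial>lborel))"
proof -
  have q: "qplus M (1 - u) = ereal (tail_quantile u)" if "u \<in> {\<beta><..<\<beta>+a}" for u
    using that assms qplus_eq_quantile[of "1 - u"] by (auto simp: tail_quantile_def)
  have "(\<integral>\<^sup>+u\<in>{\<beta><..<\<beta>+a}. e2ennreal (qplus M (1 - u)) \<partial>lborel)
      = (\<integral>\<^sup>+u. ennreal (indicator {\<beta><..<\<beta>+a} u * tail_quantile u) \<partial>lborel)"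
    by (intro nn_integral_cong) (auto simp: indicator_def q)
  moreover have "(\<integral>\<^sup>+u\<in>{\<beta><..<\<beta>+a}. e2ennreal (- qplus M (1 - u)) \<partial>lborel)
      = (\<integral>\<^sup>+u. ennreal (- (indicator {\<beta><..<\<beta>+a} u * tail_quantile u)) \<partial>lborel)"
    by (intro nn_integral_cong) (auto simp: indicator_def q)
  ultimately show ?thesis unfolding rvar_def by simp
qed

definition tail_integral :: "real \<Rightarrow> real \<Rightarrow> real" where
  "tail_integral r b = (LINT y:{r..b}|lborel. measure M {y<..})"

definition clip :: "real \<Rightarrow> real \<Rightarrow> real \<Rightarrow> real" where
  "clip r b u = max r (min b (tail_quantile u))"

lemma measurable_clip[measurable]: "clip r b \<in> borel_measurable borel"
  unfolding clip_def[abs_def] by measurable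

lemma clip_bounds: "r \<le> b \<Longrightarrow> r \<le> clip r b u \<and> clip r b u \<le> b"
  unfolding clip_def by auto

text \<open>Tonelli for the region of all (y, u) with r \<le> y \<le> b and 0 < u < 1 - C y: its
  section at y has length 1 - C y, its section at u has length
  \<open>clip r b u - r\<close>.\<close>

lemma tail_integral_eq_clip:
  assumes "r \<le> b"
  shows "tail_integral r b = (LINT u|lborel. indicator {0<..<1} u * (clip r b u - r))"
proof -
  have "(\<integral>\<^sup>+y. ennreal (indicator {r..b} y * measure M {y<..}) \<partial>lborel)
      = (\<integral>\<^sup>+y. (\<integral>\<^sup>+u. indicator {p. r \<le> fst p \<and> fst p \<le> b \<and> 0 < snd p \<and> snd p < 1 \<and> snd p < 1 - C (fst p)} (y, u) \<partial>lborel) \<partial>lborel)"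
  proof (intro nn_integral_cong)
    fix y :: real
    have "(\<integral>\<^sup>+u. indicator {p. r \<le> fst p \<and> fst p \<le> b \<and> 0 < snd p \<and> snd p < 1 \<and> snd p < 1 - C (fst p)} (y, u) \<partial>lborel)
      = (\<integral>\<^sup>+u. indicator {r..b} y * indicator {0<..<1 - C y} u \<partial>lborel)"
      using cdf_nonneg[of y] by (intro nn_integral_cong) (auto simp: indicator_def)
    also have "\<dots> = indicator {r..b} y * ennreal (1 - C y)"
      using cdf_bounded_prob[of y] by (simp add: nn_integral_cmult)
    finally show "ennreal (indicator {r..b} y * measure M {y<..}) = (\<integral>\<^sup>+u. indicator {p. r \<le> fst p \<and> fst p \<le> b \<and> 0 < snd p \<and> snd p < 1 \<and> snd p < 1 - C (fst p)} (y, u) \<partial>lborel)"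
      by (auto simp: measure_greaterThan indicator_def)
  qed
  also have "\<dots> = (\<integral>\<^sup>+u. (\<integral>\<^sup>+y. indicator {p. r \<le> fst p \<and> fst p \<le> b \<and> 0 < snd p \<and> snd p < 1 \<and> snd p < 1 - C (fst p)} (y, u) \<partial>lborel) \<partial>lborel)"
    by (rule lborel_pair.Fubini') measurable
  also have "\<dots> = (\<integral>\<^sup>+u. ennreal (indicator {0<..<1} u * (clip r b u - r)) \<partial>lborel)"
  proof (intro nn_integral_cong)
    fix u :: real
    show "(\<integral>\<^sup>+y. indicator {p. r \<le> fst p \<and> fst p \<le> b \<and> 0 < snd p \<and> snd p < 1 \<and> snd p < 1 - C (fst p)} (y, u) \<partial>lborel)
        = ennreal (indicator {0<..<1} u * (clip r b u - r))"
    proof (cases "u \<in> {0<..<1}")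
      case True
      \<comment> \<open>Hence the section at u is cut off by b or by the tail quantile, whichever is
        smaller; it is empty, of length 0, if the tail quantile is at most r.\<close>
      have iff: "u < 1 - C y \<longleftrightarrow> y < tail_quantile u" for y
        using tail_quantile_le_iff[of u y] True by auto
      have "(\<integral>\<^sup>+y. indicator {p. r \<le> fst p \<and> fst p \<le> b \<and> 0 < snd p \<and> snd p < 1 \<and> snd p < 1 - C (fst p)} (y, u) \<partial>lborel)
        = (\<integral>\<^sup>+y. indicator (if b < tail_quantile u then {r..b} else {r..<tail_quantile u}) y \<partial>lborel)"
        using True iff by (intro nn_integral_cong) (auto simp: indicator_def)
      also have "\<dots> = ennreal (clip r b u - r)"
        using assms by (auto simp: clip_def min_def max_def)
      finally show ?thesis using True by simp
    qed auto
  qed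
  finally have eq: "(\<integral>\<^sup>+y. ennreal (indicator {r..b} y * measure M {y<..}) \<partial>lborel)
    = (\<integral>\<^sup>+u. ennreal (indicator {0<..<1} u * (clip r b u - r)) \<partial>lborel)" .
  have m: "(\<lambda>y. measure M {y<..}) \<in> borel_measurable borel"
    unfolding measure_greaterThan by measurable
  show ?thesis unfolding tail_integral_def set_lebesgue_integral_def
    using m eq clip_bounds[OF assms]
    by (subst (1 2) integral_eq_nn_integral) (auto simp: indicator_def)
qed

lemma integrable_clip:
  assumes "r \<le> b" "0 \<le> s" "s' \<le> 1"
  shows "integrable lborel (\<lambda>u. indicator {s<..<s'} u * clip r b u)"
proof (rule Bochner_Integration.integrable_bound)
  show "integrable lborel (\<lambda>u. indicator {s<..<s'} u * max \<bar>r\<bar> \<bar>b\<bar>)"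
    by (cases "s \<le> s'") (auto intro!: integrable_mult_left integrable_real_indicator)
  show "AE u in lborel. norm (indicator {s<..<s'} u * clip r b u) \<le> norm (indicator {s<..<s'} u * max \<bar>r\<bar> \<bar>b\<bar>)"
  proof (intro AE_I2)
    fix u :: real
    have "\<bar>clip r b u\<bar> \<le> max \<bar>r\<bar> \<bar>b\<bar>" using clip_bounds[OF assms(1), of u] by linarith
    then show "norm (indicator {s<..<s'} u * clip r b u) \<le> norm (indicator {s<..<s'} u * max \<bar>r\<bar> \<bar>b\<bar>)"
      by (auto split: split_indicator)
  qed
qed simp

definition clip_integral :: "real \<Rightarrow> real \<Rightarrow> real \<Rightarrow> real \<Rightarrow> real" where
  "clip_integral \<beta> a r b = (LINT u|lborel. indicator {\<beta><..<\<beta>+a} u * clip r b u)"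

text \<open>The derivative in b is 1 - \<beta> - C b and the one in r is C r - (1 - \<beta> - a). So
  for fixed r a maximum in b lies where C b = 1 - \<beta>, and for fixed b a minimum in r lies where
  C r = 1 - \<beta> - a.\<close>

definition saddle :: "real \<Rightarrow> real \<Rightarrow> real \<Rightarrow> real \<Rightarrow> real" where
  "saddle \<beta> a r b = tail_integral r b + r * (\<beta> + a) - b * \<beta>"

text \<open>Prepares pointwise comparisons with \<open>clip_integral\<close>: the integrand is clip
  - b \<le> 0 on (0, \<beta>], clip on (\<beta>, \<beta> + a), and clip - r \<ge> 0 on [\<beta> + a,
  1).\<close>

lemma saddle_eq:
  assumes "r \<le> b" "0 \<le> \<beta>" "0 < a" "\<beta> + a \<le> 1"
  shows "integrable lborel (\<lambda>u. indicator {0<..<1} u * (clip r b u - r)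
            + r * indicator {0<..<\<beta>+a} u - b * indicator {0<..\<beta>} u)"
    and "saddle \<beta> a r b = (LINT u|lborel. indicator {0<..<1} u * (clip r b u - r)
            + r * indicator {0<..<\<beta>+a} u - b * indicator {0<..\<beta>} u)"
proof -
  have i: "integrable lborel (\<lambda>u. indicator {0<..<1} u * (clip r b u - r))"
    using integrable_clip[OF assms(1), of 0 1] 
    by (simp add: right_diff_distrib integrable_real_indicator)
  have j: "integrable lborel (\<lambda>u. r * indicator {0<..<\<beta>+a} u)"
      "integrable lborel (\<lambda>u. b * indicator {0<..\<beta>} u)"
    using assms by (auto intro!: integrable_mult_right integrable_real_indicator)
  show "integrable lborel (\<lambda>u. indicator {0<..<1} u * (clip r b u - r)
            + r * indicator {0<..<\<beta>+a} u - b * indicator {0<..\<beta>} u)"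
    using i j by simp
  show "saddle \<beta> a r b = (LINT u|lborel. indicator {0<..<1} u * (clip r b u - r)
            + r * indicator {0<..<\<beta>+a} u - b * indicator {0<..\<beta>} u)"
    using i j assms unfolding saddle_def tail_integral_eq_clip[OF assms(1)] by simp
qed

text \<open>On (0, \<beta>] the integrand of \<open>saddle_eq\<close> is at least r - b, so at most
  \<beta> (b - r) is lost there. This serves the case in which b is not matched to \<beta>.\<close>

lemma clip_integral_le_saddle_slack:
  assumes "r \<le> b" "0 \<le> \<beta>" "0 < a" "\<beta> + a \<le> 1"
  shows "clip_integral \<beta> a r b \<le> saddle \<beta> a r b + \<beta> * (b - r)"
proof -
  have "clip_integral \<beta> a r b \<le> (LINT u|lborel. (indicator {0<..<1} u * (clip r b u - r)
            + r * indicator {0<..<\<beta>+a} u - b * indicator {0<..\<beta>} u) + (b - r) * indicator {0<..\<beta>} u)"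
    unfolding clip_integral_def
  proof (rule integral_mono)
    show "integrable lborel (\<lambda>u. (indicator {0<..<1} u * (clip r b u - r)
            + r * indicator {0<..<\<beta>+a} u - b * indicator {0<..\<beta>} u) + (b - r) * indicator {0<..\<beta>} u)"
      using saddle_eq(1)[OF assms] assms by (auto intro!: Bochner_Integration.integrable_add integrable_mult_right integrable_real_indicator)
    show "integrable lborel (\<lambda>u. indicator {\<beta><..<\<beta>+a} u * clip r b u)"
      using assms by (intro integrable_clip) auto
  qed (use assms clip_bounds[OF assms(1)] in \<open>auto split: split_indicator\<close>)
  also have "\<dots> = saddle \<beta> a r b + \<beta> * (b - r)"
    using saddle_eq[OF assms] assms by (subst Bochner_Integration.integral_add) (auto intro!: integrable_mult_right integrable_real_indicator)
  finally show ?thesis .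
qed

text \<open>If C b \<le> 1 - \<beta>, the tail quantile is at least b on (0, \<beta>], so the
  negative piece of the integrand of \<open>saddle_eq\<close> vanishes.\<close>

lemma clip_integral_le_saddle:
  assumes "r \<le> b" "0 \<le> \<beta>" "0 < a" "\<beta> + a \<le> 1" "C b \<le> 1 - \<beta>"
  shows "clip_integral \<beta> a r b \<le> saddle \<beta> a r b"
proof -
  have "clip r b u = b" if "0 < u" "u \<le> \<beta>" for u
  proof -
    have u: "u < 1" using that assms by simp
    \<comment> \<open>For u < \<beta> monotonicity suffices. At u = \<beta> a tail quantile below b
      would produce a flat piece of \<open>C\<close> at the level 1 - \<beta>, which
      \<open>cdf_inj\<close> excludes.\<close>
    have "b \<le> tail_quantile u"
    proof (rule ccontr)
      assume n: "\<not> b \<le> tail_quantile u"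
      have "1 - u \<le> C (tail_quantile u)" using tail_quantile_le_iff[of u] that u by auto
      with n cdf_nondecreasing[of "tail_quantile u" b] have "C (tail_quantile u) = 1 - u" "C b = 1 - u"
        using that assms by auto
      then show False using cdf_inj[of b "tail_quantile u"] n that u by simp
    qed
    then show ?thesis using assms(1) by (simp add: clip_def)
  qed
  then show ?thesis unfolding clip_integral_def saddle_eq(2)[OF assms(1-4)]
    using assms clip_bounds[OF assms(1)] saddle_eq(1)[OF assms(1-4)]
    by (intro integral_mono integrable_clip) (auto split: split_indicator)
qed

text \<open>If C r \<ge> 1 - \<beta> - a, the tail quantile is at most r on [\<beta> + a, 1), so the
  positive extra piece of the integrand of \<open>saddle_eq\<close> vanishes.\<close>

lemma saddle_le_clip_integral:
  assumes "r \<le> b" "0 \<le> \<beta>" "0 < a" "\<beta> + a \<le> 1" "1 - \<beta> - a \<le> C r"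
  shows "saddle \<beta> a r b \<le> clip_integral \<beta> a r b"
proof -
  have "clip r b u = r" if "\<beta> + a \<le> u" "u < 1" for u
    using tail_quantile_le_iff[of u r] that assms by (auto simp: clip_def)
  then show ?thesis unfolding clip_integral_def saddle_eq(2)[OF assms(1-4)]
    using assms clip_bounds[OF assms(1)] saddle_eq(1)[OF assms(1-4)]
    by (intro integral_mono integrable_clip) (auto split: split_indicator)
qed

text \<open>The tail quantile does not exceed b on (\<beta>, \<beta> + a), so clipping can only
  raise it there.\<close>

lemma rvar_le_clip_integral:
  assumes "r \<le> b" "0 \<le> \<beta>" "0 < a" "\<beta> + a \<le> 1" "1 - \<beta> \<le> C b"
  shows "rvar \<beta> a M \<le> ereal (clip_integral \<beta> a r b / a)"
proof -
  let ?f = "\<lambda>u. indicator {\<beta><..<\<beta>+a} u * tail_quantile u"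
  let ?g = "\<lambda>u. indicator {\<beta><..<\<beta>+a} u * clip r b u"
  have le: "?f u \<le> ?g u" for u
    using tail_quantile_le_iff[of u b] assms by (auto simp: indicator_def clip_def)
  have int: "integrable lborel ?g" using assms by (intro integrable_clip) auto
  have "enn2ereal (\<integral>\<^sup>+u. ennreal (?f u) \<partial>lborel) - enn2ereal (\<integral>\<^sup>+u. ennreal (- ?f u) \<partial>lborel)
      \<le> enn2ereal (\<integral>\<^sup>+u. ennreal (?g u) \<partial>lborel) - enn2ereal (\<integral>\<^sup>+u. ennreal (- ?g u) \<partial>lborel)"
    by (intro nn_integral_diff_mono le)
  also have "\<dots> = ereal (clip_integral \<beta> a r b)"
    unfolding clip_integral_def using ereal_integral_eq_nn_integral_diff[OF int] by simp
  finally have "ereal (1/a) * (enn2ereal (\<integral>\<^sup>+u. ennreal (?f u) \<partial>lborel) - enn2ereal (\<integral>\<^sup>+u. ennreal (- ?f u) \<partial>lborel))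
     \<le> ereal (1/a) * ereal (clip_integral \<beta> a r b)"
    using assms by (intro ereal_mult_left_mono) auto
  then show ?thesis unfolding rvar_eq[OF assms(2-4)] by simp
qed

text \<open>The tail quantile is not below r on (\<beta>, \<beta> + a), so clipping can only lower
  it there.\<close>

lemma clip_integral_le_rvar:
  assumes "r \<le> b" "0 \<le> \<beta>" "0 < a" "\<beta> + a \<le> 1" "C r \<le> 1 - \<beta> - a"
  shows "ereal (clip_integral \<beta> a r b / a) \<le> rvar \<beta> a M"
proof -
  let ?f = "\<lambda>u. indicator {\<beta><..<\<beta>+a} u * tail_quantile u"
  let ?g = "\<lambda>u. indicator {\<beta><..<\<beta>+a} u * clip r b u"
  have le: "?g u \<le> ?f u" for u
    using tail_quantile_le_iff[of u r] assms by (auto simp: indicator_def clip_def)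
  have int: "integrable lborel ?g" using assms by (intro integrable_clip) auto
  have "ereal (clip_integral \<beta> a r b) = enn2ereal (\<integral>\<^sup>+u. ennreal (?g u) \<partial>lborel) - enn2ereal (\<integral>\<^sup>+u. ennreal (- ?g u) \<partial>lborel)"
    unfolding clip_integral_def using ereal_integral_eq_nn_integral_diff[OF int] by simp
  also have "\<dots> \<le> enn2ereal (\<integral>\<^sup>+u. ennreal (?f u) \<partial>lborel) - enn2ereal (\<integral>\<^sup>+u. ennreal (- ?f u) \<partial>lborel)"
    by (intro nn_integral_diff_mono le)
  finally have "ereal (1/a) * ereal (clip_integral \<beta> a r b) \<le> ereal (1/a) * (enn2ereal (\<integral>\<^sup>+u. ennreal (?f u) \<partial>lborel) - enn2ereal (\<integral>\<^sup>+u. ennreal (- ?f u) \<partial>lborel))"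
    using assms by (intro ereal_mult_left_mono) auto
  then show ?thesis unfolding rvar_eq[OF assms(2-4)] by simp
qed


section \<open>Differentiation of the saddle function in its endpoints\<close>

definition primitive :: "real \<Rightarrow> real" where
  "primitive = (SOME \<Phi>. \<forall>y. (\<Phi> has_real_derivative 1 - C y) (at y))"

lemma DERIV_primitive: "(primitive has_real_derivative 1 - C y) (at y)"
proof -
  \<comment> \<open>Continuity of \<open>C\<close> gives an antiderivative on the whole line. Its
    additive constant is irrelevant, since only differences of \<open>primitive\<close>
    occur.\<close>
  have "\<exists>\<Phi>. \<forall>y::real. -\<infinity> < ereal y \<longrightarrow> ereal y < \<infinity> \<longrightarrow> (\<Phi> has_vector_derivative 1 - C y) (at y)"
    by (rule einterval_antiderivative) (auto intro!: continuous_intros isCont_cdf_all)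
  then have "\<exists>\<Phi>. \<forall>y. (\<Phi> has_real_derivative 1 - C y) (at y)"
    by (simp add: has_real_derivative_iff_has_vector_derivative)
  from someI_ex[OF this] show ?thesis unfolding primitive_def by blast
qed

lemma tail_integral_eq_primitive:
  assumes "r \<le> b"
  shows "tail_integral r b = primitive b - primitive r"
  unfolding tail_integral_def set_lebesgue_integral_def measure_greaterThan
  using assms by (intro integral_FTC_Icc)
    (auto intro!: continuous_intros continuous_at_imp_continuous_on isCont_cdf_all
      DERIV_subset[OF DERIV_primitive] simp flip: has_real_derivative_iff_has_vector_derivative)

lemma primitive_MVT:
  assumes "r < b"
  obtains z where "r < z" "z < b" "primitive b - primitive r = (b - r) * (1 - C z)"
  using MVT2[OF assms, of primitive "\<lambda>y. 1 - C y"] DERIV_primitive by blast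

lemma primitive_diff_bounds:
  assumes "r \<le> b"
  shows "primitive b - primitive r \<le> (b - r) * (1 - C r)"
    and "(b - r) * (1 - C b) \<le> primitive b - primitive r"
proof -
  have "(b - r) * (1 - C b) \<le> primitive b - primitive r \<and> primitive b - primitive r \<le> (b - r) * (1 - C r)"
  proof (cases "r = b")
    case False
    then obtain z where z: "r < z" "z < b" "primitive b - primitive r = (b - r) * (1 - C z)"
      using primitive_MVT assms by (metis order_le_less)
    then show ?thesis using cdf_nondecreasing[of r z] cdf_nondecreasing[of z b]
      by (auto intro!: mult_left_mono)
  qed simp
  then show "primitive b - primitive r \<le> (b - r) * (1 - C r)"
    and "(b - r) * (1 - C b) \<le> primitive b - primitive r" by auto
qed

lemma saddle_eq_primitive:
  "r \<le> b \<Longrightarrow> saddle \<beta> a r b = primitive b - primitive r + r * (\<beta> + a) - b * \<beta>"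
  unfolding saddle_def by (simp add: tail_integral_eq_primitive)

lemma DERIV_saddle:
  "((\<lambda>b. primitive b - primitive r + r * (\<beta> + a) - b * \<beta>) has_real_derivative 1 - C b - \<beta>) (at b)"
  by (auto intro!: derivative_eq_intros DERIV_primitive)

section \<open>Average quantiles bounded by saddle values\<close>

lemma rvar_le_saddle:
  assumes "r \<le> b" "0 \<le> \<beta>" "0 < a" "\<beta> + a \<le> 1" "C b = 1 - \<beta>"
  shows "rvar \<beta> a M \<le> ereal (saddle \<beta> a r b / a)"
proof -
  have "rvar \<beta> a M \<le> ereal (clip_integral \<beta> a r b / a)"
    using assms by (intro rvar_le_clip_integral) auto
  also have "\<dots> \<le> ereal (saddle \<beta> a r b / a)"
    using clip_integral_le_saddle[of r b \<beta> a] assms by (simp add: divide_right_mono)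
  finally show ?thesis .
qed

lemma rvar_le_saddle_slack:
  assumes "r \<le> b" "0 \<le> \<beta>" "0 < a" "\<beta> + a \<le> 1" "1 - \<beta> \<le> C b"
  shows "rvar \<beta> a M \<le> ereal ((saddle \<beta> a r b + \<beta> * (b - r)) / a)"
proof -
  have "rvar \<beta> a M \<le> ereal (clip_integral \<beta> a r b / a)"
    using assms by (intro rvar_le_clip_integral) auto
  also have "\<dots> \<le> ereal ((saddle \<beta> a r b + \<beta> * (b - r)) / a)"
    using clip_integral_le_saddle_slack[of r b \<beta> a] assms by (simp add: divide_right_mono)
  finally show ?thesis .
qed

lemma saddle_le_rvar:
  assumes "r \<le> b" "0 \<le> \<beta>" "0 < a" "\<beta> + a \<le> 1" "C r = 1 - \<beta> - a"
  shows "ereal (saddle \<beta> a r b / a) \<le> rvar \<beta> a M"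
proof -
  have "ereal (saddle \<beta> a r b / a) \<le> ereal (clip_integral \<beta> a r b / a)"
    using saddle_le_clip_integral[of r b \<beta> a] assms by (simp add: divide_right_mono)
  also have "\<dots> \<le> rvar \<beta> a M"
    using assms by (intro clip_integral_le_rvar) auto
  finally show ?thesis .
qed

text \<open>At b = r the saddle function has the value r a and the derivative 1 - C r - \<beta> = a
  > 0, so a slightly larger b already gives a lower bound for a R that exceeds r a.\<close>

lemma less_rvar:
  assumes "0 \<le> \<beta>" "0 < a" "\<beta> + a \<le> 1" "C r = 1 - \<beta> - a"
  shows "ereal r < rvar \<beta> a M"
proof -
  obtain d where d: "0 < d" "\<And>h. 0 < h \<Longrightarrow> h < d \<Longrightarrow> primitive r - primitive r + r * (\<beta> + a) - r * \<beta>
      < primitive (r + h) - primitive r + r * (\<beta> + a) - (r + h) * \<beta>"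
    using DERIV_pos_inc_right[OF DERIV_saddle[of r \<beta> a r]] assms by auto
  have "r * a < saddle \<beta> a r (r + d/2)"
    using d(2)[of "d/2"] d(1) by (simp add: saddle_eq_primitive algebra_simps)
  then have "ereal r < ereal (saddle \<beta> a r (r + d/2) / a)" using assms by (simp add: field_simps)
  also have "\<dots> \<le> rvar \<beta> a M" using assms d by (intro saddle_le_rvar) auto
  finally show ?thesis .
qed

lemma cdf_eq_if_saddle_max:
  assumes "r < b" and max: "\<And>y. r \<le> y \<Longrightarrow> saddle \<beta> a r y \<le> saddle \<beta> a r b"
  shows "C b = 1 - \<beta>"
proof -
  have "1 - C b - \<beta> = 0"
  proof (rule DERIV_local_max[OF DERIV_saddle[of r \<beta> a b], of "b - r"])
    show "\<forall>y. \<bar>b - y\<bar> < b - r \<longrightarrow> primitive y - primitive r + r * (\<beta> + a) - y * \<beta>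
        \<le> primitive b - primitive r + r * (\<beta> + a) - b * \<beta>"
    proof (intro allI impI)
      fix y assume "\<bar>b - y\<bar> < b - r"
      then have "r \<le> y" by linarith
      then show "primitive y - primitive r + r * (\<beta> + a) - y * \<beta>
        \<le> primitive b - primitive r + r * (\<beta> + a) - b * \<beta>"
        using max[of y] assms(1) by (simp add: saddle_eq_primitive)
    qed
  qed (use assms in simp)
  then show ?thesis by simp
qed

text \<open>Supplies one coordinate of a point for the dual problem. The bound is uniform in b
  because the common width b - r is known only after all coordinates have been chosen. Away from
  level 0, r is the quantile at 1 - \<beta> - a.\<close>

lemma ex_saddle_le_of_rvar_less:
  assumes "0 \<le> \<beta>" "0 < a" "\<beta> + a \<le> 1" "rvar \<beta> a M < ereal y"
  obtains r where "r < y" "\<And>b. r \<le> b \<Longrightarrow> saddle \<beta> a r b \<le> a * y"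
proof (cases "\<beta> + a = 1")
  case False
  then have v: "0 < 1 - \<beta> - a" "1 - \<beta> - a < 1" using assms by auto
  define r where "r = I (1 - \<beta> - a)"
  have c: "C r = 1 - \<beta> - a" unfolding r_def using cdf_quantile v by blast
  show ?thesis
  proof
    show "r < y" using less_rvar[OF assms(1-3) c] assms(4)
      by (metis less_ereal.simps(1) order.strict_trans)
    fix b assume "r \<le> b"
    then have "ereal (saddle \<beta> a r b / a) < ereal y"
      using saddle_le_rvar[OF _ assms(1-3) c] assms(4) by (metis order.strict_trans1)
    then show "saddle \<beta> a r b \<le> a * y" using assms(2) by (simp add: field_simps)
  qed
next
  txt \<open>At level \<open>0\<close> the quantile may be \<open>-\<infinity>\<close>, and so may be \<open>rvar\<close>; truncation from below
    approximates it.\<close>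
  case True
  let ?J = "{\<beta><..<\<beta>+a}"
  let ?f = "\<lambda>u. indicator ?J u * tail_quantile u"
  let ?g = "\<lambda>k u. indicator ?J u * max (- real k) (tail_quantile u)"
  let ?P = "\<integral>\<^sup>+u. ennreal (?f u) \<partial>lborel" and ?N = "\<integral>\<^sup>+u. ennreal (- ?f u) \<partial>lborel"
  let ?Nk = "\<lambda>k. \<integral>\<^sup>+u. ennreal (- ?g k u) \<partial>lborel"
  have less: "enn2ereal ?P - enn2ereal ?N < ereal (a * y)"
    using assms(2,4) unfolding rvar_eq[OF assms(1-3)]
    by (cases "enn2ereal ?P - enn2ereal ?N") (auto simp: field_simps)
  then have P: "enn2ereal ?P \<noteq> \<infinity>" by auto
  \<comment> \<open>Truncation at a level - k \<le> 0 leaves the positive part unchanged; only the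
    negative parts have to converge.\<close>
  have Pk: "(\<integral>\<^sup>+u. ennreal (?g k u) \<partial>lborel) = ?P" for k
    by (intro nn_integral_cong) (auto split: split_indicator simp: max_def ennreal_neg)
  have "?Nk \<longlonglongrightarrow> ?N"
  proof (rule nn_integral_LIMSEQ)
    show "incseq (\<lambda>k u. ennreal (- ?g k u))"
      by (auto simp: incseq_def le_fun_def intro!: ennreal_leI split: split_indicator)
    show "(\<lambda>k. ennreal (- ?g k u)) \<longlonglongrightarrow> ennreal (- ?f u)" for u
    proof (rule tendsto_eventually)
      obtain K :: nat where "- tail_quantile u \<le> real K" using real_arch_simple by blast
      then show "\<forall>\<^sub>F k in sequentially. ennreal (- ?g k u) = ennreal (- ?f u)"
        by (intro eventually_sequentiallyI[of K]) (auto split: split_indicator simp: max_def)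
    qed
  qed measurable
  then have "(\<lambda>k. enn2ereal ?P - enn2ereal (?Nk k)) \<longlonglongrightarrow> enn2ereal ?P - enn2ereal ?N"
    using P enn2ereal_nonneg[of ?P] by (intro tendsto_diff_ereal_general tendsto_const tendsto_enn2erealI) auto
  then have "\<forall>\<^sub>F k in sequentially. enn2ereal ?P - enn2ereal (?Nk k) < ereal (a * y)"
    using less by (rule order_tendstoD)
  moreover have "\<forall>\<^sub>F k in sequentially. - y < real k"
    using filterlim_real_sequentially by (simp add: filterlim_at_top_dense)
  ultimately obtain k where k: "enn2ereal ?P - enn2ereal (?Nk k) < ereal (a * y)" "- y < real k"
    by (metis (mono_tags, lifting) eventually_conj eventually_happens' sequentially_bot)
  show ?thesis
  proof
    show "- real k < y" using k by simp
    fix b assume b: "- real k \<le> b"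
    \<comment> \<open>At level 0 the condition on the left endpoint is merely that \<open>C\<close>
      is nonnegative.\<close>
    have "saddle \<beta> a (- real k) b \<le> clip_integral \<beta> a (- real k) b"
      using assms b True cdf_nonneg[of "- real k"] by (intro saddle_le_clip_integral) auto
    moreover have "ereal (clip_integral \<beta> a (- real k) b) < ereal (a * y)"
    proof -
      have "integrable lborel (\<lambda>u. indicator ?J u * clip (- real k) b u)"
        using b assms by (intro integrable_clip) auto
      note ereal_integral_eq_nn_integral_diff[OF this]
      also have "enn2ereal (\<integral>\<^sup>+u. ennreal (indicator ?J u * clip (- real k) b u) \<partial>lborel)
          - enn2ereal (\<integral>\<^sup>+u. ennreal (- (indicator ?J u * clip (- real k) b u)) \<partial>lborel)
        \<le> enn2ereal (\<integral>\<^sup>+u. ennreal (?g k u) \<partial>lborel) - enn2ereal (?Nk k)"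
        by (intro nn_integral_diff_mono) (auto split: split_indicator simp: clip_def)
      also have "\<dots> < ereal (a * y)" unfolding Pk by (rule k)
      finally show ?thesis unfolding clip_integral_def .
    qed
    ultimately show "saddle \<beta> a (- real k) b \<le> a * y" by simp
  qed
qed

text \<open>Compactness handles a middle interval, and in the two tails \<open>C\<close> itself
  varies by less than \<epsilon>. The margin 1 around [A, B] and a radius at most 1 keep two close
  points in a common region.\<close>

lemma cdf_uniformly_continuous:
  assumes "0 < \<epsilon>"
  obtains \<delta> where "0 < \<delta>" "\<And>x y. \<bar>x - y\<bar> < \<delta> \<Longrightarrow> \<bar>C x - C y\<bar> < \<epsilon>"
proof -
  have "\<forall>\<^sub>F x in at_bot. C x < \<epsilon>" using cdf_lim_at_bot assms by (rule order_tendstoD)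
  then obtain A where A: "C A < \<epsilon>" by (metis eventually_happens' trivial_limit_at_bot_linorder)
  have "\<forall>\<^sub>F x in at_top. 1 - \<epsilon> < C x" using cdf_lim_at_top_prob assms by (intro order_tendstoD(1)[where y=1]) auto
  then obtain B where B: "1 - \<epsilon> < C B" by (metis eventually_happens' trivial_limit_at_top_linorder)
  have "uniformly_continuous_on {A-1..B+1} C"
    using continuous_cdf by (intro compact_uniformly_continuous) (auto intro: continuous_on_subset)
  then obtain d where d: "0 < d" "\<And>x y. x \<in> {A-1..B+1} \<Longrightarrow> y \<in> {A-1..B+1} \<Longrightarrow> \<bar>x - y\<bar> < d \<Longrightarrow> \<bar>C x - C y\<bar> < \<epsilon>"
    using assms unfolding uniformly_continuous_on_def dist_real_def by metis
  show ?thesis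
  proof (rule that[of "min d 1"])
    fix x y :: real assume xy: "\<bar>x - y\<bar> < min d 1"
    consider "x \<in> {A-1..B+1}" "y \<in> {A-1..B+1}" | "x \<le> A" "y \<le> A" | "B \<le> x" "B \<le> y"
      using xy by fastforce
    then show "\<bar>C x - C y\<bar> < \<epsilon>"
    proof cases
      case 1 then show ?thesis using d(2) xy by auto
    next
      case 2 then show ?thesis using A cdf_nondecreasing[of x A] cdf_nondecreasing[of y A] cdf_nonneg[of x] cdf_nonneg[of y] by linarith
    next
      case 3 then show ?thesis using B cdf_nondecreasing[of B x] cdf_nondecreasing[of B y] cdf_bounded_prob[of x] cdf_bounded_prob[of y] by linarith
    qed
  qed (use d in auto)
qed

lemma ex_cdf_eq:
  assumes "0 < v" "v < 1"
  obtains y where "C y = v"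
  using cdf_quantile assms by blast

text \<open>The measure is concentrated on (a, b]. This supplies the finite means demanded when
  \<beta>_0 = 1.\<close>

lemma integrable_bounded_support:
  assumes "C a = 0" "C b = 1"
  shows "integrable M (\<lambda>y. y)"
proof (rule integrable_const_bound[where B="max \<bar>a\<bar> \<bar>b\<bar>"])
  have "AE y in M. y \<in> {a<..}" using assms measure_greaterThan[of a] by (subst AE_in_set_eq_1) auto
  moreover have "AE y in M. y \<in> {..b}" using assms by (subst AE_in_set_eq_1) (auto simp: cdf_def2)
  ultimately show "AE y in M. norm y \<le> max \<bar>a\<bar> \<bar>b\<bar>" by eventually_elim auto
qed simp

end

section \<open>The optimization problems for several distributions\<close>

lemma Delta_iff:
  "\<beta> \<in> (Delta :: (real \<times> (real ^ 'n::finite)) set) \<longleftrightarrow>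
    0 < fst \<beta> \<and> (\<forall>i. 0 \<le> snd \<beta> $ i) \<and> fst \<beta> + (\<Sum>i\<in>UNIV. snd \<beta> $ i) = 1"
proof -
  have "fst \<beta> \<le> 1 \<and> (\<forall>i. snd \<beta> $ i \<le> 1)"
    if "0 < fst \<beta>" "\<forall>i. 0 \<le> snd \<beta> $ i" "fst \<beta> + (\<Sum>i\<in>UNIV. snd \<beta> $ i) = 1"
  proof -
    have "snd \<beta> $ i \<le> (\<Sum>i\<in>UNIV. snd \<beta> $ i)" for i using that by (intro member_le_sum) auto
    moreover have "0 \<le> (\<Sum>i\<in>UNIV. snd \<beta> $ i)" using that by (intro sum_nonneg) auto
    ultimately show ?thesis using that by (smt (verit))
  qed
  then show ?thesis unfolding Delta_def by auto
qed

lemma closure_Delta_iff: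
  "\<beta> \<in> closure (Delta :: (real \<times> (real ^ 'n::finite)) set) \<longleftrightarrow>
    0 \<le> fst \<beta> \<and> (\<forall>i. 0 \<le> snd \<beta> $ i) \<and> fst \<beta> + (\<Sum>i\<in>UNIV. snd \<beta> $ i) = 1"
proof
  let ?S = "{\<beta> :: real \<times> (real ^ 'n). 0 \<le> fst \<beta> \<and> (\<forall>i. 0 \<le> snd \<beta> $ i) \<and> fst \<beta> + (\<Sum>i\<in>UNIV. snd \<beta> $ i) = 1}"
  have "closed ?S"
    by (intro closed_Collect_conj closed_Collect_all closed_Collect_le closed_Collect_eq continuous_intros)
  then have "closure Delta \<subseteq> ?S" by (intro closure_minimal) (auto simp: Delta_iff)
  then show "\<beta> \<in> closure Delta \<Longrightarrow> 0 \<le> fst \<beta> \<and> (\<forall>i. 0 \<le> snd \<beta> $ i) \<and> fst \<beta> + (\<Sum>i\<in>UNIV. snd \<beta> $ i) = 1"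
    by blast
next
  assume \<beta>: "0 \<le> fst \<beta> \<and> (\<forall>i. 0 \<le> snd \<beta> $ i) \<and> fst \<beta> + (\<Sum>i\<in>UNIV. snd \<beta> $ i) = 1"
  \<comment> \<open>Convex combinations with the vertex (1, 0) have a positive first coordinate and
    tend to \<beta>.\<close>
  define b where "b n = (1 - inverse (real (Suc n))) *\<^sub>R \<beta> + inverse (real (Suc n)) *\<^sub>R (1, 0 :: real ^ 'n)" for n
  have "b n \<in> Delta" for n
  proof -
    define e where "e = inverse (real (Suc n))"
    have e: "0 < e" "e \<le> 1" unfolding e_def by (auto simp: field_simps)
    have "(1 - e) * fst \<beta> + e + (\<Sum>i\<in>UNIV. (1 - e) * snd \<beta> $ i)
        = (1 - e) * (fst \<beta> + (\<Sum>i\<in>UNIV. snd \<beta> $ i)) + e"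
      by (simp add: sum_distrib_left algebra_simps)
    also have "\<dots> = 1" using \<beta> by simp
    moreover have "0 \<le> (1 - e) * fst \<beta>" using \<beta> e by (intro mult_nonneg_nonneg) auto
    moreover have "fst (b n) = (1 - e) * fst \<beta> + e" "snd (b n) $ i = (1 - e) * snd \<beta> $ i" for i
      unfolding b_def e_def by simp_all
    ultimately show ?thesis using \<beta> e unfolding Delta_iff by (simp add: add_nonneg_pos)
  qed
  moreover have "b \<longlonglongrightarrow> (1 - 0) *\<^sub>R \<beta> + 0 *\<^sub>R (1, 0)"
    unfolding b_def[abs_def] by (intro tendsto_intros LIMSEQ_inverse_real_of_nat)
  ultimately show "\<beta> \<in> closure Delta" by (auto simp: closure_sequential zero_prod_def[symmetric])
qed

lemma scaled_Delta_iff: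
  assumes "0 < c"
  shows "\<beta> \<in> (scaled_Delta c :: (real \<times> (real ^ 'n::finite)) set) \<longleftrightarrow>
    0 < fst \<beta> \<and> (\<forall>i. 0 \<le> snd \<beta> $ i) \<and> fst \<beta> + (\<Sum>i\<in>UNIV. snd \<beta> $ i) = c"
proof -
  have eq: "fst \<beta> / c + (\<Sum>i\<in>UNIV. snd \<beta> $ i / c) = 1 \<longleftrightarrow> fst \<beta> + (\<Sum>i\<in>UNIV. snd \<beta> $ i) = c"
    using assms by (auto simp: sum_divide_distrib[symmetric] add_divide_distrib[symmetric])
  have "\<beta> \<in> scaled_Delta c \<longleftrightarrow> (1 / c) *\<^sub>R \<beta> \<in> Delta"
    using assms unfolding scaled_Delta_def by (auto intro!: image_eqI[where x="(1 / c) *\<^sub>R \<beta>"])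
  also have "\<dots> \<longleftrightarrow> 0 < fst \<beta> \<and> (\<forall>i. 0 \<le> snd \<beta> $ i) \<and> fst \<beta> + (\<Sum>i\<in>UNIV. snd \<beta> $ i) = c"
    using assms eq by (simp add: Delta_iff zero_le_divide_iff zero_less_divide_iff)
  finally show ?thesis .
qed

lemma scaled_closed_Delta_iff:
  assumes "0 < c"
  shows "\<beta> \<in> (scaled_closed_Delta c :: (real \<times> (real ^ 'n::finite)) set) \<longleftrightarrow>
    0 \<le> fst \<beta> \<and> (\<forall>i. 0 \<le> snd \<beta> $ i) \<and> fst \<beta> + (\<Sum>i\<in>UNIV. snd \<beta> $ i) = c"
proof -
  have eq: "fst \<beta> / c + (\<Sum>i\<in>UNIV. snd \<beta> $ i / c) = 1 \<longleftrightarrow> fst \<beta> + (\<Sum>i\<in>UNIV. snd \<beta> $ i) = c"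
    using assms by (auto simp: sum_divide_distrib[symmetric] add_divide_distrib[symmetric])
  have "\<beta> \<in> scaled_closed_Delta c \<longleftrightarrow> (1 / c) *\<^sub>R \<beta> \<in> closure Delta"
    using assms unfolding scaled_closed_Delta_def by (auto intro!: image_eqI[where x="(1 / c) *\<^sub>R \<beta>"])
  also have "\<dots> \<longleftrightarrow> 0 \<le> fst \<beta> \<and> (\<forall>i. 0 \<le> snd \<beta> $ i) \<and> fst \<beta> + (\<Sum>i\<in>UNIV. snd \<beta> $ i) = c"
    using assms eq by (simp add: closure_Delta_iff zero_le_divide_iff zero_less_divide_iff)
  finally show ?thesis .
qed

lemma closure_Delta_below: "closure (Delta_below x) = {r :: real ^ 'n::finite. (\<Sum>i\<in>UNIV. r $ i) \<le> x}"
proof -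
  have "(\<chi> i. (1 :: real)) \<noteq> (0 :: real ^ 'n)" by (simp add: vec_eq_iff)
  from closure_halfspace_lt[OF this, of x] show ?thesis
    unfolding Delta_below_def by (simp add: inner_vec_def)
qed

text \<open>Spreads the strict room below x over the terms. A term equal to -\<infinity> admits any
  real bound, so in that case the bound for the remaining terms is chosen first.\<close>

lemma ereal_sum_less_split:
  fixes f :: "'a \<Rightarrow> ereal"
  assumes "finite A" "\<And>i. i \<in> A \<Longrightarrow> f i \<noteq> \<infinity>" "sum f A < ereal x"
  shows "\<exists>y. (\<forall>i\<in>A. f i < ereal (y i)) \<and> sum y A < x"
  using assms
proof (induction A arbitrary: x rule: finite_induct)
  case (insert a A)
  have S: "sum f A \<noteq> \<infinity>" using insert by (auto simp: sum_Pinfty)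
  have "\<exists>p z. f a < ereal p \<and> sum f A < ereal z \<and> p + z = x"
  proof (cases "f a")
    case (real w)
    then have "sum f A < ereal (x - w)" using insert.prems(2) insert.hyps
      by (cases "sum f A") auto
    then obtain z where "sum f A < ereal z" "z < x - w"
      by (metis ereal_dense2 less_ereal.simps(1))
    then show ?thesis using real by (intro exI[of _ "x - z"] exI[of _ z]) auto
  next
    case MInf
    obtain z where "sum f A < ereal z" using S by (metis ereal_dense2 less_PInf_Ex_of_nat linorder_not_less ereal_infty_less_eq(1) top_ereal_def)
    then show ?thesis using MInf by (intro exI[of _ "x - z"] exI[of _ z]) auto
  qed (use insert.prems in auto)
  then obtain p z where pz: "f a < ereal p" "sum f A < ereal z" "p + z = x" by blast
  then obtain y where y: "\<forall>i\<in>A. f i < ereal (y i)" "sum y A < z"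
    using insert.IH[of z] insert.prems by auto
  have "sum (y(a := p)) A = sum y A" using insert.hyps by (intro sum.cong) auto
  then have "sum (y(a := p)) (insert a A) = p + sum y A" using insert.hyps by simp
  then show ?case using pz y insert.hyps by (intro exI[of _ "y(a := p)"]) auto
qed simp

section \<open>The dual objective and sums of saddle functions\<close>

locale continuous_quantile_family =
  fixes \<mu> :: "'n::finite \<Rightarrow> real measure"
  assumes continuous_quantile_distribution: "continuous_quantile_distribution (\<mu> i)"
begin

sublocale m: continuous_quantile_distribution "\<mu> i" for i
  by (rule continuous_quantile_distribution)

abbreviation total :: "real ^ 'n \<Rightarrow> real" where
  "total r \<equiv> (\<Sum>i\<in>UNIV. r $ i)"

text \<open>For points below x this is the dual objective multiplied by the width x -
  \<open>total r\<close>, which avoids quotients in comparisons and derivatives.\<close>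

definition excess :: "real \<Rightarrow> real ^ 'n \<Rightarrow> real" where
  "excess x r = (\<Sum>i\<in>UNIV. m.primitive i (r $ i + (x - total r)) - m.primitive i (r $ i))"

lemma dual_obj_eq:
  assumes "total r < x"
  shows "dual_obj \<mu> x r = excess x r / (x - total r)"
proof -
  have "(LINT y:{r $ i..x - total r + r $ i}|lborel. measure (\<mu> i) {y<..})
      = m.primitive i (r $ i + (x - total r)) - m.primitive i (r $ i)" for i
    using m.tail_integral_eq_primitive[of "r $ i" "x - total r + r $ i" i] assms
    unfolding m.tail_integral_def by (simp add: add.commute)
  then show ?thesis
    using assms unfolding dual_obj_def Let_def excess_def by (simp add: sum_divide_distrib)
qed

lemma dual_obj_boundary:
  "total r = x \<Longrightarrow> dual_obj \<mu> x r = (\<Sum>i\<in>UNIV. 1 - cdf (\<mu> i) (r $ i))"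
  unfolding dual_obj_def Let_def by (simp add: m.measure_greaterThan)

lemma dual_obj_nonneg:
  assumes "r \<in> Delta_below x"
  shows "0 \<le> dual_obj \<mu> x r"
proof -
  have d: "0 < x - total r" using assms by (simp add: Delta_below_def)
  have "0 \<le> m.primitive i (r $ i + (x - total r)) - m.primitive i (r $ i)" for i
  proof -
    have "0 \<le> (x - total r) * (1 - cdf (\<mu> i) (r $ i + (x - total r)))"
      using d m.cdf_bounded_prob by (intro mult_nonneg_nonneg) auto
    then show ?thesis using m.primitive_diff_bounds(2)[of "r $ i" "r $ i + (x - total r)" i] d by simp
  qed
  then have "0 \<le> excess x r" unfolding excess_def by (intro sum_nonneg) auto
  then show ?thesis using d by (simp add: dual_obj_eq)
qed

lemma bdd_below_dual_obj: "bdd_below (dual_obj \<mu> x ` Delta_below x)"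
  by (rule bdd_belowI2[of _ 0]) (rule dual_obj_nonneg)

lemma Delta_below_nonempty: "Delta_below x \<noteq> ({} :: (real ^ 'n) set)"
proof -
  have "(\<chi> i. (x - 1) / real CARD('n)) \<in> (Delta_below x :: (real ^ 'n) set)"
    by (simp add: Delta_below_def)
  then show ?thesis by blast
qed

lemma dual_bound_less_iff:
  "dual_bound \<mu> x < a \<longleftrightarrow> (\<exists>r\<in>Delta_below x. dual_obj \<mu> x r < a)"
  unfolding dual_bound_def by (rule cINF_less_iff[OF Delta_below_nonempty bdd_below_dual_obj])

lemma dual_bound_le: "total r < x \<Longrightarrow> dual_bound \<mu> x \<le> dual_obj \<mu> x r"
  unfolding dual_bound_def by (rule cINF_lower[OF bdd_below_dual_obj]) (simp add: Delta_below_def)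

text \<open>With a common width d the products r_i \<beta>_i cancel. The linear part becomes
  \<beta>_0 \<open>total r\<close> - d (c - \<beta>_0), which is \<beta>_0 x - c d.\<close>

lemma sum_saddle_eq:
  assumes "total r \<le> x" "fst \<beta> + total (snd \<beta>) = c"
  shows "(\<Sum>i\<in>UNIV. m.saddle i (snd \<beta> $ i) (fst \<beta>) (r $ i) (r $ i + (x - total r)))
    = fst \<beta> * x + (excess x r - c * (x - total r))"
proof -
  let ?d = "x - total r"
  have "(\<Sum>i\<in>UNIV. m.saddle i (snd \<beta> $ i) (fst \<beta>) (r $ i) (r $ i + ?d))
     = (\<Sum>i\<in>UNIV. (m.primitive i (r $ i + ?d) - m.primitive i (r $ i)) + fst \<beta> * r $ i - ?d * snd \<beta> $ i)"
    using assms by (intro sum.cong) (auto simp: m.saddle_eq_primitive algebra_simps)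
  also have "\<dots> = excess x r + fst \<beta> * total r - ?d * total (snd \<beta>)"
    unfolding excess_def by (simp add: sum.distrib sum_subtractf sum_distrib_left)
  also have "total (snd \<beta>) = c - fst \<beta>" using assms by simp
  finally show ?thesis by (simp add: algebra_simps)
qed

section \<open>The two inequalities between the optimal values\<close>

lemma simplex_le:
  assumes "\<forall>i. 0 \<le> snd \<beta> $ i" "fst \<beta> + total (snd \<beta>) = c"
  shows "snd \<beta> $ i + fst \<beta> \<le> c"
proof -
  have "snd \<beta> $ i \<le> total (snd \<beta>)" using assms(1) by (intro member_le_sum) auto
  then show ?thesis using assms(2) by linarith
qed

text \<open>If \<beta>_0 > 0, points r_i adapted to the single terms make the sum of saddle
  functions less than \<beta>_0 x, and \<open>sum_saddle_eq\<close> turns this into a dual objective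
  below c. If \<beta>_0 = 0, the quantiles themselves serve as r_i.\<close>

lemma dual_bound_less_of_conv_obj_less:
  assumes c: "0 < c" "c \<le> 1" and \<beta>: "\<beta> \<in> scaled_closed_Delta c" "conv_defined \<mu> \<beta>"
    and less: "conv_obj \<mu> \<beta> < ereal x"
  shows "dual_bound \<mu> x < c"
proof -
  note b = \<beta>(1)[unfolded scaled_closed_Delta_iff[OF c(1)]]
  have le: "snd \<beta> $ i + fst \<beta> \<le> 1" for i using simplex_le[of \<beta> c i] b c by auto
  have fin: "conv_term \<mu> \<beta> i \<noteq> \<infinity>" for i
  proof
    assume "conv_term \<mu> \<beta> i = \<infinity>"
    then have "conv_obj \<mu> \<beta> = \<infinity>" unfolding conv_obj_def sum_Pinfty by auto
    then show False using less by simp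
  qed
  obtain y where y: "\<And>i. conv_term \<mu> \<beta> i < ereal (y i)" "sum y UNIV < x"
    using ereal_sum_less_split[of UNIV "conv_term \<mu> \<beta>" x] fin less unfolding conv_obj_def by auto
  show ?thesis
  proof (cases "fst \<beta> = 0")
    case False
    then have b0: "0 < fst \<beta>" using b by simp
    define P where "P i r \<longleftrightarrow> r < y i \<and> (\<forall>b\<ge>r. m.saddle i (snd \<beta> $ i) (fst \<beta>) r b \<le> fst \<beta> * y i)" for i r
    have "\<exists>r. P i r" for i
    proof -
      have "rvar (snd \<beta> $ i) (fst \<beta>) (\<mu> i) < ereal (y i)" using y(1)[of i] False by (simp add: conv_term_def)
      then obtain r where "r < y i" "\<And>b. r \<le> b \<Longrightarrow> m.saddle i (snd \<beta> $ i) (fst \<beta>) r b \<le> fst \<beta> * y i"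
        using m.ex_saddle_le_of_rvar_less[of "snd \<beta> $ i" "fst \<beta>" i "y i"] b b0 le[of i] by blast
      then show ?thesis unfolding P_def by blast
    qed
    then obtain \<rho> where "\<And>i. P i (\<rho> i)" by metis
    then have \<rho>: "\<rho> i < y i"
      "\<rho> i \<le> b \<Longrightarrow> m.saddle i (snd \<beta> $ i) (fst \<beta>) (\<rho> i) b \<le> fst \<beta> * y i" for i b
      unfolding P_def by blast+
    define r :: "real ^ 'n" where "r = (\<chi> i. \<rho> i)"
    have "total r \<le> sum y UNIV" unfolding r_def using \<rho>(1) by (simp add: sum_mono less_imp_le)
    then have rx: "total r < x" using y by simp
    have "fst \<beta> * x + (excess x r - c * (x - total r))
      = (\<Sum>i\<in>UNIV. m.saddle i (snd \<beta> $ i) (fst \<beta>) (r $ i) (r $ i + (x - total r)))"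
      using sum_saddle_eq[of r x \<beta> c] b rx by simp
    also have "\<dots> \<le> (\<Sum>i\<in>UNIV. fst \<beta> * y i)"
      using \<rho>(2) rx unfolding r_def by (intro sum_mono) auto
    also have "\<dots> < fst \<beta> * x" using y(2) b0 by (simp add: sum_distrib_left[symmetric])
    finally have "excess x r < c * (x - total r)" by simp
    then have "dual_obj \<mu> x r < c" using rx by (simp add: dual_obj_eq divide_less_eq)
    then show ?thesis using rx by (auto simp: dual_bound_less_iff Delta_below_def)
  next
    case True
    then have lt1: "snd \<beta> $ i < 1" for i using \<beta>(2) unfolding conv_defined_def by auto
    have "\<exists>r. qminus (\<mu> i) (1 - snd \<beta> $ i) = ereal r" for i
      using fin[of i] m.qminus_neq_MInf[of "1 - snd \<beta> $ i" i] lt1[of i] True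
      unfolding conv_term_def by (cases "qminus (\<mu> i) (1 - snd \<beta> $ i)") auto
    then have "\<forall>i. \<exists>r. qminus (\<mu> i) (1 - snd \<beta> $ i) = ereal r" by blast
    from choice[OF this] obtain \<rho> where "\<forall>i. qminus (\<mu> i) (1 - snd \<beta> $ i) = ereal (\<rho> i)"
      by (rule exE)
    then have \<rho>: "qminus (\<mu> i) (1 - snd \<beta> $ i) = ereal (\<rho> i)" for i by simp
    define r :: "real ^ 'n" where "r = (\<chi> i. \<rho> i)"
    have F: "cdf (\<mu> i) (r $ i) = 1 - snd \<beta> $ i" for i
      using m.cdf_of_qminus[OF \<rho>[of i]] lt1[of i] b unfolding r_def by auto
    have "total r \<le> sum y UNIV"
    proof -
      have "\<rho> i \<le> y i" for i using y(1)[of i] \<rho>[of i] True by (simp add: conv_term_def)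
      then show ?thesis unfolding r_def by (simp add: sum_mono)
    qed
    then have rx: "0 < x - total r" using y by simp
    \<comment> \<open>The integrand 1 - F_i is at most its value \<beta>_i at the left endpoint r_i.
      Summing gives only a weak inequality; strictness comes from an i with \<beta>_i > 0, since F_i
      increases strictly at r_i.\<close>
    have w: "m.primitive i (r $ i + (x - total r)) - m.primitive i (r $ i) \<le> (x - total r) * snd \<beta> $ i" for i
      using m.primitive_diff_bounds(1)[of "r $ i" "r $ i + (x - total r)" i] rx F by simp
    have "\<exists>i. snd \<beta> $ i > 0"
    proof (rule ccontr)
      assume "\<not> ?thesis"
      then have "total (snd \<beta>) \<le> 0" by (intro sum_nonpos) (simp add: not_less)
      then show False using b True c by simp
    qed
    then obtain i where i: "snd \<beta> $ i > 0" by blast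
    obtain z where z: "r $ i < z" "m.primitive i (r $ i + (x - total r)) - m.primitive i (r $ i) = (x - total r) * (1 - cdf (\<mu> i) z)"
      using m.primitive_MVT[of "r $ i" "r $ i + (x - total r)" i] rx by auto
    have "cdf (\<mu> i) (r $ i) < cdf (\<mu> i) z" using m.cdf_strict[OF z(1), of i] F[of i] i lt1[of i] by simp
    then have s: "m.primitive i (r $ i + (x - total r)) - m.primitive i (r $ i) < (x - total r) * snd \<beta> $ i"
      using z rx F[of i] by simp
    have "excess x r < (\<Sum>i\<in>UNIV. (x - total r) * snd \<beta> $ i)"
      unfolding excess_def by (rule sum_strict_mono_ex1) (use w s in auto)
    also have "\<dots> = c * (x - total r)" using b True by (simp add: sum_distrib_left[symmetric])
    finally have "dual_obj \<mu> x r < c" using rx by (simp add: dual_obj_eq divide_less_eq)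
    then show ?thesis using rx by (auto simp: dual_bound_less_iff Delta_below_def)
  qed
qed

text \<open>A dual point r of width d determines \<beta> by \<beta>_i = 1 - F_i(r_i + d), with the
  remaining mass as \<beta>_0; then \<open>rvar_le_saddle\<close> and \<open>sum_saddle_eq\<close>
  bound the objective by x.\<close>

lemma conv_inf_le_of_dual_bound_less:
  assumes t: "0 \<le> t" "t < 1" and less: "dual_bound \<mu> x < 1 - t"
  shows "conv_inf \<mu> t \<le> ereal x"
proof -
  obtain r where r: "total r < x" "dual_obj \<mu> x r < 1 - t"
    using less by (auto simp: dual_bound_less_iff Delta_below_def)
  define d where "d = x - total r"
  have d: "0 < d" using r by (simp add: d_def)
  have E: "excess x r < (1 - t) * d" using r d by (simp add: dual_obj_eq d_def divide_less_eq)
  \<comment> \<open>The numbers s_i measure a deviation from the canonical \<beta>_i: a mismatched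
    coordinate costs at most s_i d, and the total cost must fit into the gap between
    \<open>excess x r\<close> and (1 - t) d.\<close>
  have *: "conv_inf \<mu> t \<le> ereal x"
    if "0 < b0" "\<And>i. 0 \<le> b i" "b0 + sum b UNIV = 1 - t" "b0 = 1 \<Longrightarrow> False"
      "\<And>i. 1 - b i \<le> cdf (\<mu> i) (r $ i + d)"
      "\<And>i. cdf (\<mu> i) (r $ i + d) \<noteq> 1 - b i \<Longrightarrow> b i \<le> s i"
      "\<And>i. 0 \<le> s i" "excess x r + sum s UNIV * d \<le> (1 - t) * d" for b0 b s
  proof -
    define \<beta> :: "real \<times> (real ^ 'n)" where "\<beta> = (b0, \<chi> i. b i)"
    have \<beta>: "fst \<beta> = b0" "snd \<beta> $ i = b i" for i unfolding \<beta>_def by auto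
    have in_scaled: "\<beta> \<in> scaled_Delta (1 - t)" using that t by (subst scaled_Delta_iff) (auto simp: \<beta>)
    have le: "b i + b0 \<le> 1" for i using simplex_le[of \<beta> "1 - t" i] that t by (simp add: \<beta>)
    have R: "rvar (b i) b0 (\<mu> i) \<le> ereal ((m.saddle i (b i) b0 (r $ i) (r $ i + d) + s i * d) / b0)" for i
    proof (cases "cdf (\<mu> i) (r $ i + d) = 1 - b i")
      case True
      then have "rvar (b i) b0 (\<mu> i) \<le> ereal (m.saddle i (b i) b0 (r $ i) (r $ i + d) / b0)"
        using d that le by (intro m.rvar_le_saddle) auto
      also have "\<dots> \<le> ereal ((m.saddle i (b i) b0 (r $ i) (r $ i + d) + s i * d) / b0)"
        using that d by (simp add: divide_right_mono)
      finally show ?thesis .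
    next
      case False
      have "rvar (b i) b0 (\<mu> i) \<le> ereal ((m.saddle i (b i) b0 (r $ i) (r $ i + d) + b i * (r $ i + d - r $ i)) / b0)"
        using d that le by (intro m.rvar_le_saddle_slack) auto
      also have "\<dots> \<le> ereal ((m.saddle i (b i) b0 (r $ i) (r $ i + d) + s i * d) / b0)"
        using that(1) that(6)[OF False] d by (simp add: divide_right_mono)
      finally show ?thesis .
    qed
    then have "rvar (b i) b0 (\<mu> i) \<noteq> \<infinity>" for i by (metis ereal_infty_less_eq(1) PInfty_neq_ereal(1))
    then have "conv_defined \<mu> \<beta>" using that unfolding conv_defined_def conv_term_def \<beta> by auto
    then have "conv_inf \<mu> t \<le> conv_obj \<mu> \<beta>" unfolding conv_inf_def using in_scaled by (intro INF_lower) auto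
    also have "conv_obj \<mu> \<beta> = (\<Sum>i\<in>UNIV. rvar (b i) b0 (\<mu> i))"
      unfolding conv_obj_def conv_term_def \<beta> using that by simp
    also have "\<dots> \<le> (\<Sum>i\<in>UNIV. ereal ((m.saddle i (b i) b0 (r $ i) (r $ i + d) + s i * d) / b0))"
      by (intro sum_mono R)
    also have "\<dots> = ereal (((\<Sum>i\<in>UNIV. m.saddle i (b i) b0 (r $ i) (r $ i + d)) + sum s UNIV * d) / b0)"
      by (simp add: sum.distrib sum_divide_distrib[symmetric] sum_distrib_right)
    also have "(\<Sum>i\<in>UNIV. m.saddle i (b i) b0 (r $ i) (r $ i + d)) = b0 * x + (excess x r - (1 - t) * d)"
      using sum_saddle_eq[of r x \<beta> "1 - t"] that r by (simp add: \<beta> d_def)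
    also have "ereal ((b0 * x + (excess x r - (1 - t) * d) + sum s UNIV * d) / b0) \<le> ereal x"
      using that by (simp add: divide_le_eq mult.commute)
    finally show ?thesis .
  qed
  define b where "b i = 1 - cdf (\<mu> i) (r $ i + d)" for i
  have b: "0 \<le> b i" for i unfolding b_def using m.cdf_bounded_prob by simp
  \<comment> \<open>Each integral over a window is at least d times the value of 1 - F_i at its
    right endpoint. This leaves a positive \<beta>_0.\<close>
  have "sum b UNIV * d \<le> excess x r"
    unfolding excess_def sum_distrib_right b_def d_def[symmetric]
    using m.primitive_diff_bounds(2)[of "r $ i" "r $ i + d" i for i] d by (intro sum_mono) (simp add: mult.commute)
  then have "sum b UNIV * d < (1 - t) * d" using E by simp
  then have sb: "sum b UNIV < 1 - t" using d by simp
  show ?thesis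
  proof (cases "1 - t - sum b UNIV = 1")
    case False
    show ?thesis
      by (rule *[of "1 - t - sum b UNIV" b "\<lambda>_. 0"]) (use False sb b E in \<open>auto simp: b_def\<close>)
  next
    case True
    have "0 \<le> sum b UNIV" using b by (intro sum_nonneg) auto
    then have t0: "t = 0" "sum b UNIV = 0" using True t by auto
    then have b0: "b i = 0" for i using b by (simp add: sum_nonneg_eq_0_iff)
    txt \<open>The canonical choice is \<open>\<beta>\<^sub>0 = 1\<close>, which is admissible only if all means are finite, so a
      little mass is moved to one other coordinate.\<close>
    define j where "j = (undefined :: 'n)"
    \<comment> \<open>The second bound is the relative gap 1 - \<open>excess x r\<close> / d, which
      pays for the cost \<epsilon> d; the bound 1/2 keeps \<beta>_0 = 1 - \<epsilon>
      positive.\<close>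
    define \<epsilon> where "\<epsilon> = min (1/2) (1 - excess x r / d)"
    have \<epsilon>: "0 < \<epsilon>" "\<epsilon> < 1" "excess x r + \<epsilon> * d \<le> d"
    proof -
      show "0 < \<epsilon>" "\<epsilon> < 1" using E d t0 by (auto simp: \<epsilon>_def divide_less_eq)
      have "\<epsilon> * d \<le> (1 - excess x r / d) * d" unfolding \<epsilon>_def using d by (intro mult_right_mono) auto
      then show "excess x r + \<epsilon> * d \<le> d" using d by (simp add: left_diff_distrib)
    qed
    show ?thesis
      by (rule *[of "1 - \<epsilon>" "\<lambda>i. if i = j then \<epsilon> else 0" "\<lambda>i. if i = j then \<epsilon> else 0"])
         (use \<epsilon> b0 t0 in \<open>auto simp: b_def\<close>)
  qed
qed

lemma dual_bound_inv_le: "dual_bound \<mu> x < a \<Longrightarrow> dual_bound_inv \<mu> a \<le> ereal x"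
  unfolding dual_bound_inv_def by (intro INF_lower) auto

text \<open>Covers the closed simplex, so that it also bounds the objective from below at boundary
  points, which do not enter \<open>conv_inf\<close>.\<close>

lemma dual_bound_inv_le_conv_obj:
  assumes "0 < c" "c \<le> 1" "\<beta> \<in> scaled_closed_Delta c" "conv_defined \<mu> \<beta>"
  shows "dual_bound_inv \<mu> c \<le> conv_obj \<mu> \<beta>"
proof (rule ccontr)
  assume "\<not> ?thesis"
  then obtain x where "conv_obj \<mu> \<beta> < ereal x" "ereal x < dual_bound_inv \<mu> c"
    by (meson ereal_dense2 not_le)
  then show False using dual_bound_less_of_conv_obj_less[OF assms] dual_bound_inv_le
    by (meson not_le)
qed

lemma conv_inf_eq_dual_bound_inv:
  assumes t: "0 \<le> t" "t < 1"
  shows "conv_inf \<mu> t = dual_bound_inv \<mu> (1 - t)"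
proof (rule antisym)
  show "conv_inf \<mu> t \<le> dual_bound_inv \<mu> (1 - t)"
    unfolding dual_bound_inv_def by (intro INF_greatest) (auto intro: conv_inf_le_of_dual_bound_less[OF t])
  show "dual_bound_inv \<mu> (1 - t) \<le> conv_inf \<mu> t"
    unfolding conv_inf_def using t
    by (intro INF_greatest dual_bound_inv_le_conv_obj)
       (auto simp: scaled_Delta_iff scaled_closed_Delta_iff)
qed

section \<open>Continuity of the dual bound and finiteness of its inverse\<close>

lemma dual_bound_uniformly_continuous:
  assumes "0 < \<epsilon>"
  obtains \<eta> where "0 < \<eta>" "\<And>x x' a. \<bar>x - x'\<bar> < \<eta> \<Longrightarrow> dual_bound \<mu> x < a \<Longrightarrow> dual_bound \<mu> x' < a + \<epsilon>"
proof -
  let ?n = "real CARD('n)"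
  have "\<exists>\<delta>>0. \<forall>x y. \<bar>x - y\<bar> < \<delta> \<longrightarrow> \<bar>cdf (\<mu> i) x - cdf (\<mu> i) y\<bar> < \<epsilon> / ?n" for i
    using m.cdf_uniformly_continuous[of "\<epsilon> / ?n" i] assms by (metis divide_pos_pos of_nat_0_less_iff zero_less_card_finite)
  then obtain \<delta> where \<delta>: "\<And>i. 0 < \<delta> i" "\<And>i x y. \<bar>x - y\<bar> < \<delta> i \<Longrightarrow> \<bar>cdf (\<mu> i) x - cdf (\<mu> i) y\<bar> < \<epsilon> / ?n"
    by metis
  define \<delta>' where "\<delta>' = Min (range \<delta>)"
  have \<delta>': "0 < \<delta>'" "\<delta>' \<le> \<delta> i" for i
    unfolding \<delta>'_def using \<delta>(1) by (auto simp: Min_gr_iff)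
  show ?thesis
  proof (rule that[of "?n * \<delta>'"])
    show "0 < ?n * \<delta>'" using \<delta>' by simp
    fix x x' a assume close: "\<bar>x - x'\<bar> < ?n * \<delta>'" and "dual_bound \<mu> x < a"
    then obtain r where r: "total r < x" "dual_obj \<mu> x r < a"
      by (auto simp: dual_bound_less_iff Delta_below_def)
    \<comment> \<open>Shifting every coordinate by h changes the total by x' - x and thus preserves
      the width d, so each window is only translated by h. The resulting change of the objective is
      small uniformly in r.\<close>
    define h where "h = (x' - x) / ?n"
    have h: "\<bar>h\<bar> < \<delta>'" using close unfolding h_def by (simp add: divide_less_eq mult.commute abs_minus_commute)
    define r' :: "real ^ 'n" where "r' = (\<chi> i. r $ i + h)"
    define d where "d = x - total r"
    have d: "0 < d" using r by (simp add: d_def)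
    have "total r' = total r + ?n * h" unfolding r'_def by (simp add: sum.distrib)
    then have d': "x' - total r' = d" unfolding h_def d_def by simp
    have "m.primitive i (r' $ i + d) - m.primitive i (r' $ i)
        \<le> m.primitive i (r $ i + d) - m.primitive i (r $ i) + d * (\<epsilon> / ?n)" for i
    proof -
      \<comment> \<open>The mean value theorem for the map sending s to \<open>primitive\<close> (s
        + h) - \<open>primitive\<close> s, whose derivative is a difference of two nearby values of
        F_i.\<close>
      have "\<exists>z>r $ i. z < r $ i + d \<and> (m.primitive i (r $ i + d + h) - m.primitive i (r $ i + d))
          - (m.primitive i (r $ i + h) - m.primitive i (r $ i))
          = (r $ i + d - r $ i) * ((1 - cdf (\<mu> i) (z + h)) - (1 - cdf (\<mu> i) z))"
        using d by (intro MVT2) (auto intro!: derivative_eq_intros DERIV_shift[THEN iffD1] m.DERIV_primitive)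
      then obtain z where z: "(m.primitive i (r $ i + d + h) - m.primitive i (r $ i + d))
          - (m.primitive i (r $ i + h) - m.primitive i (r $ i)) = d * (cdf (\<mu> i) z - cdf (\<mu> i) (z + h))" by auto
      have "\<bar>cdf (\<mu> i) z - cdf (\<mu> i) (z + h)\<bar> < \<epsilon> / ?n" using h \<delta>'(2)[of i] by (intro \<delta>(2)) auto
      then have "d * (cdf (\<mu> i) z - cdf (\<mu> i) (z + h)) \<le> d * (\<epsilon> / ?n)" using d by (intro mult_left_mono) auto
      then show ?thesis using z unfolding r'_def by (simp add: algebra_simps)
    qed
    then have "excess x' r' \<le> (\<Sum>i\<in>UNIV. m.primitive i (r $ i + d) - m.primitive i (r $ i) + d * (\<epsilon> / ?n))"
      unfolding excess_def d' by (intro sum_mono)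
    also have "\<dots> = excess x r + d * \<epsilon>" unfolding excess_def d_def[symmetric] by (simp add: sum.distrib)
    also have "excess x r < a * d" using r d by (simp add: dual_obj_eq d_def divide_less_eq)
    finally have "excess x' r' < (a + \<epsilon>) * d" by (simp add: algebra_simps)
    then have "dual_obj \<mu> x' r' < a + \<epsilon>" using d d' by (simp add: dual_obj_eq divide_less_eq)
    then show "dual_bound \<mu> x' < a + \<epsilon>" using d d' by (auto simp: dual_bound_less_iff Delta_below_def)
  qed
qed

text \<open>A value below c at \<xi> would persist slightly to the left of \<xi>, against the choice
  of the infimum. A value above c would persist slightly to the right, where the infimum supplies
  points with value below c.\<close>

lemma dual_bound_at_inverse:
  assumes "dual_bound_inv \<mu> c = ereal \<xi>"
  shows "dual_bound \<mu> \<xi> = c"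
proof (rule antisym)
  show "c \<le> dual_bound \<mu> \<xi>"
  proof (rule ccontr)
    assume "\<not> ?thesis"
    then obtain a where a: "dual_bound \<mu> \<xi> < a" "a < c" using dense not_le by metis
    then have "0 < c - a" by simp
    then obtain \<eta> where \<eta>: "0 < \<eta>" "\<And>x x' b. \<bar>x - x'\<bar> < \<eta> \<Longrightarrow> dual_bound \<mu> x < b \<Longrightarrow> dual_bound \<mu> x' < b + (c - a)"
      using dual_bound_uniformly_continuous by metis
    have "dual_bound \<mu> (\<xi> - \<eta> / 2) < c" using \<eta>(2)[of \<xi> "\<xi> - \<eta> / 2" a] \<eta>(1) a by simp
    then have "ereal \<xi> \<le> ereal (\<xi> - \<eta> / 2)" using dual_bound_inv_le assms by metis
    then show False using \<eta> by simp
  qed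
  show "dual_bound \<mu> \<xi> \<le> c"
  proof (rule ccontr)
    assume "\<not> ?thesis"
    then have "0 < dual_bound \<mu> \<xi> - c" by simp
    then obtain \<eta> where \<eta>: "0 < \<eta>" "\<And>x x' b. \<bar>x - x'\<bar> < \<eta> \<Longrightarrow> dual_bound \<mu> x < b \<Longrightarrow> dual_bound \<mu> x' < b + (dual_bound \<mu> \<xi> - c)"
      using dual_bound_uniformly_continuous by metis
    have "dual_bound_inv \<mu> c < ereal (\<xi> + \<eta>)" using assms \<eta>(1) by simp
    then obtain x where x: "dual_bound \<mu> x < c" "x < \<xi> + \<eta>"
      unfolding dual_bound_inv_def INF_less_iff by auto
    have "ereal \<xi> \<le> ereal x" using dual_bound_inv_le[OF x(1)] assms by simp
    then have "dual_bound \<mu> \<xi> < c + (dual_bound \<mu> \<xi> - c)" using x by (intro \<eta>(2)) auto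
    then show False by simp
  qed
qed

text \<open>The constant vector B with width 1 is a witness once all tails beyond B are below c /
  n.\<close>

lemma dual_bound_inv_neq_PInf:
  assumes "0 < c"
  shows "dual_bound_inv \<mu> c \<noteq> \<infinity>"
proof -
  let ?n = "real CARD('n)"
  have "\<forall>\<^sub>F x in at_top. \<forall>i. 1 - c / ?n < cdf (\<mu> i) x"
    using assms by (intro eventually_all_finite order_tendstoD(1)[OF m.cdf_lim_at_top_prob]) auto
  then obtain B where B: "\<And>i. 1 - c / ?n < cdf (\<mu> i) B"
    using eventually_happens'[OF trivial_limit_at_top_linorder] by blast
  define r :: "real ^ 'n" where "r = (\<chi> i. B)"
  have tr: "total r = ?n * B" unfolding r_def by simp
  have "m.primitive i (r $ i + 1) - m.primitive i (r $ i) < c / ?n" for i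
    using m.primitive_diff_bounds(1)[of "r $ i" "r $ i + 1" i] B[of i] by (simp add: r_def)
  then have "excess (?n * B + 1) r < (\<Sum>i\<in>(UNIV :: 'n set). c / ?n)"
    unfolding excess_def tr by (intro sum_strict_mono) auto
  then have "dual_obj \<mu> (?n * B + 1) r < c" by (simp add: dual_obj_eq tr)
  then have "dual_bound \<mu> (?n * B + 1) < c"
    unfolding dual_bound_less_iff by (intro bexI[of _ r]) (auto simp: Delta_below_def tr)
  then show ?thesis using dual_bound_inv_le by fastforce
qed

text \<open>Left of a common point A all tails exceed c. For x < n A, either some window lies left
  of A and alone contributes c d, or the i-th window contributes at least c (A - r_i) for every i,
  and these numbers add up to c (n A - \<open>total r\<close>) \<ge> c d.\<close>

lemma dual_bound_inv_neq_MInf: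
  assumes "0 \<le> c" "c < 1"
  shows "dual_bound_inv \<mu> c \<noteq> -\<infinity>"
proof -
  let ?n = "real CARD('n)"
  have "\<forall>\<^sub>F x in at_bot. \<forall>i. cdf (\<mu> i) x < 1 - c"
    using assms by (intro eventually_all_finite order_tendstoD(2)[OF m.cdf_lim_at_bot]) auto
  then obtain A where A: "\<And>i. cdf (\<mu> i) A < 1 - c"
    using eventually_happens'[OF trivial_limit_at_bot_linorder] by blast
  have "?n * A \<le> x" if less: "dual_bound \<mu> x < c" for x
  proof (rule ccontr)
    assume xA: "\<not> ?n * A \<le> x"
    obtain r where r: "total r < x" "dual_obj \<mu> x r < c"
      using less by (auto simp: dual_bound_less_iff Delta_below_def)
    define d where "d = x - total r"
    have d: "0 < d" using r by (simp add: d_def)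
    have E: "excess x r < c * d" using r d by (simp add: dual_obj_eq d_def divide_less_eq)
    let ?D = "\<lambda>i. m.primitive i (r $ i + d) - m.primitive i (r $ i)"
    have mono: "0 \<le> m.primitive i b - m.primitive i a" if "a \<le> b" for i a b
    proof -
      have "0 \<le> (b - a) * (1 - cdf (\<mu> i) b)"
        using that m.cdf_bounded_prob by (intro mult_nonneg_nonneg) auto
      then show ?thesis using m.primitive_diff_bounds(2)[OF that, of i] by linarith
    qed
    have low: "c * (b - a) \<le> m.primitive i b - m.primitive i a" if "a \<le> b" "b \<le> A" for i a b
    proof -
      have "c \<le> 1 - cdf (\<mu> i) b" using m.cdf_nondecreasing[OF that(2), of i] A[of i] by linarith
      then have "c * (b - a) \<le> (b - a) * (1 - cdf (\<mu> i) b)" using that by (subst mult.commute) (intro mult_left_mono, auto)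
      then show ?thesis using m.primitive_diff_bounds(2)[OF that(1), of i] by linarith
    qed
    show False
    proof (cases "\<exists>i. d \<le> A - r $ i")
      case True
      then obtain i where i: "d \<le> A - r $ i" by blast
      have "c * d \<le> ?D i" using low[of "r $ i" "r $ i + d" i] i d by simp
      also have "\<dots> \<le> excess x r" unfolding excess_def d_def[symmetric]
        using mono d by (intro member_le_sum) auto
      finally show False using E by simp
    next
      case False
      have "c * (A - r $ i) \<le> ?D i" for i
      proof (cases "r $ i \<le> A")
        case True
        then have "c * (A - r $ i) \<le> m.primitive i A - m.primitive i (r $ i)" by (intro low) auto
        also have "\<dots> \<le> ?D i"
        proof -
          have "\<not> d \<le> A - r $ i" using False by blast
          then show ?thesis using mono[of A "r $ i + d" i] by simp
        qed
        finally show ?thesis .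
      next
        case f: False
        then have "c * (A - r $ i) \<le> 0" using assms by (intro mult_nonneg_nonpos) auto
        then show ?thesis using mono[of "r $ i" "r $ i + d" i] d by simp
      qed
      then have "(\<Sum>i\<in>UNIV. c * (A - r $ i)) \<le> excess x r" unfolding excess_def d_def[symmetric] by (intro sum_mono)
      moreover have "(\<Sum>i\<in>UNIV. c * (A - r $ i)) = c * (?n * A - total r)"
        by (simp add: sum_distrib_left[symmetric] sum_subtractf)
      moreover have "c * d \<le> c * (?n * A - total r)" using xA assms unfolding d_def by (intro mult_left_mono) auto
      ultimately show False using E by simp
    qed
  qed
  then have "ereal (?n * A) \<le> dual_bound_inv \<mu> c"
    unfolding dual_bound_inv_def by (intro INF_greatest) auto
  then show ?thesis by auto
qed

section \<open>Optimality conditions for the dual problem\<close>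

lemma dual_minimizers_iff:
  assumes "dual_bound_inv \<mu> c = ereal \<xi>"
  shows "r \<in> dual_minimizers \<mu> \<xi> \<longleftrightarrow> total r \<le> \<xi> \<and>
     (if total r = \<xi> then (\<Sum>i\<in>UNIV. 1 - cdf (\<mu> i) (r $ i)) = c
      else excess \<xi> r = c * (\<xi> - total r))"
  unfolding dual_minimizers_def closure_Delta_below dual_bound_at_inverse[OF assms]
  by (auto simp: dual_obj_boundary dual_obj_eq divide_eq_eq)

lemma excess_ge:
  assumes "dual_bound_inv \<mu> c = ereal \<xi>" "total r < \<xi>"
  shows "c * (\<xi> - total r) \<le> excess \<xi> r"
  using dual_bound_le[OF assms(2)] dual_bound_at_inverse[OF assms(1)] assms(2)
  by (simp add: dual_obj_eq le_divide_eq)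

text \<open>The stationarity condition when only the \<open>i\<close>-th coordinate of \<open>r\<close> varies.\<close>

lemma dual_minimizer_first_order:
  assumes \<xi>: "dual_bound_inv \<mu> c = ereal \<xi>" and r: "r \<in> dual_minimizers \<mu> \<xi>" "total r < \<xi>"
  shows "cdf (\<mu> i) (r $ i + (\<xi> - total r)) - cdf (\<mu> i) (r $ i)
    + (\<Sum>j\<in>UNIV. 1 - cdf (\<mu> j) (r $ j + (\<xi> - total r))) = c"
proof -
  define d where "d = \<xi> - total r"
  have d: "0 < d" using r by (simp add: d_def)
  define e :: "'n \<Rightarrow> real" where "e j = (if j = i then 1 else 0)" for j
  \<comment> \<open>Moving the i-th coordinate by s shrinks the width to d - s. The function f is
    the excess minus c times the width, so it is nonnegative for \<bar>s\<bar> < d and vanishes at s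
    = 0.\<close>
  define f where "f s = (\<Sum>j\<in>UNIV. m.primitive j (r $ j + s * e j + (d - s)) - m.primitive j (r $ j + s * e j)) - c * (d - s)" for s
  have f: "f s = excess \<xi> (\<chi> j. r $ j + s * e j) - c * (\<xi> - total (\<chi> j. r $ j + s * e j))"
    "total (\<chi> j. r $ j + s * e j) = total r + s" for s
  proof -
    have "(\<Sum>j\<in>UNIV. s * e j) = s" unfolding sum_distrib_left[symmetric] by (simp add: e_def)
    then show *: "total (\<chi> j. r $ j + s * e j) = total r + s" by (simp add: sum.distrib)
    have **: "\<xi> - (total r + s) = d - s" by (simp add: d_def)
    show "f s = excess \<xi> (\<chi> j. r $ j + s * e j) - c * (\<xi> - total (\<chi> j. r $ j + s * e j))"
      unfolding f_def excess_def * ** by simp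
  qed
  have f0: "f 0 = 0"
  proof -
    have "(\<chi> j. r $ j + 0 * e j) = r" by (simp add: vec_eq_iff)
    then show ?thesis using f(1)[of 0] r unfolding dual_minimizers_iff[OF \<xi>] by simp
  qed
  have "(f has_real_derivative (\<Sum>j\<in>UNIV. (1 - cdf (\<mu> j) (r $ j + 0 * e j + (d - 0))) * (e j - 1) - (1 - cdf (\<mu> j) (r $ j + 0 * e j)) * e j) + c) (at 0)"
    unfolding f_def
    by (auto intro!: derivative_eq_intros DERIV_sum DERIV_chain2[OF m.DERIV_primitive])
  moreover have "\<forall>s. \<bar>0 - s\<bar> < d \<longrightarrow> f 0 \<le> f s"
  proof (intro allI impI)
    fix s assume "\<bar>0 - s\<bar> < d"
    then have "total (\<chi> j. r $ j + s * e j) < \<xi>" unfolding f(2) d_def by linarith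
    from excess_ge[OF \<xi> this] show "f 0 \<le> f s" unfolding f0 f(1)[of s] by simp
  qed
  ultimately have "(\<Sum>j\<in>UNIV. (1 - cdf (\<mu> j) (r $ j + d)) * (e j - 1) - (1 - cdf (\<mu> j) (r $ j)) * e j) + c = 0"
    using DERIV_local_min[of f _ 0 d] d by simp
  moreover have "(\<Sum>j\<in>UNIV. (1 - cdf (\<mu> j) (r $ j + d)) * (e j - 1) - (1 - cdf (\<mu> j) (r $ j)) * e j)
     = (\<Sum>j\<in>UNIV. (if j = i then cdf (\<mu> j) (r $ j) - cdf (\<mu> j) (r $ j + d) else 0) - (1 - cdf (\<mu> j) (r $ j + d)))"
    by (intro sum.cong) (auto simp: e_def algebra_simps)
  ultimately show ?thesis unfolding d_def[symmetric] by (simp add: sum_subtractf)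
qed

section \<open>Correspondence of minimizers\<close>

lemma corresponds_iff:
  "corresponds \<mu> x \<beta> r \<longleftrightarrow>
    (\<forall>i. cdf (\<mu> i) (r $ i) = 1 - fst \<beta> - snd \<beta> $ i \<and> cdf (\<mu> i) (r $ i + (x - total r)) = 1 - snd \<beta> $ i)"
  unfolding corresponds_def Let_def cdf_def by (simp add: add.commute)

lemma conv_minimizers_iff:
  assumes "0 \<le> t" "t < 1" "dual_bound_inv \<mu> (1 - t) = ereal \<xi>"
  shows "\<beta> \<in> conv_minimizers \<mu> t \<longleftrightarrow>
    \<beta> \<in> scaled_closed_Delta (1 - t) \<and> conv_defined \<mu> \<beta> \<and> conv_obj \<mu> \<beta> = ereal \<xi>"
  unfolding conv_minimizers_def conv_inf_eq_dual_bound_inv[OF assms(1,2)] assms(3) by simp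

text \<open>The first-order conditions say that F_i(r_i + d) - F_i(r_i) is the same number for all
  i; this number is \<beta>_0. For d = 0 it is 0, by the boundary form of the dual
  objective.\<close>

lemma ex1_corresponding_conv_point:
  assumes c: "0 < c" and \<xi>: "dual_bound_inv \<mu> c = ereal \<xi>" and r: "r \<in> dual_minimizers \<mu> \<xi>"
  shows "\<exists>!\<beta>. \<beta> \<in> scaled_closed_Delta c \<and> corresponds \<mu> \<xi> \<beta> r"
proof -
  define d where "d = \<xi> - total r"
  have d: "0 \<le> d" using r unfolding d_def dual_minimizers_iff[OF \<xi>] by simp
  define s where "s = (\<Sum>j\<in>UNIV. 1 - cdf (\<mu> j) (r $ j + d))"
  have fo: "cdf (\<mu> i) (r $ i + d) - cdf (\<mu> i) (r $ i) + s = c" for i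
  proof (cases "d = 0")
    case True
    then show ?thesis using r unfolding s_def d_def dual_minimizers_iff[OF \<xi>] by (simp split: if_splits)
  next
    case False
    then show ?thesis using dual_minimizer_first_order[OF \<xi> r, of i] d unfolding s_def d_def by simp
  qed
  show ?thesis
  proof (rule ex1I[of _ "(c - s, \<chi> i. 1 - cdf (\<mu> i) (r $ i + d))"], goal_cases)
    case 1
    have "c - s \<ge> 0" using fo[of undefined] m.cdf_nondecreasing[of "r $ undefined" "r $ undefined + d" undefined] d by simp
    moreover have "corresponds \<mu> \<xi> (c - s, \<chi> i. 1 - cdf (\<mu> i) (r $ i + d)) r"
      unfolding corresponds_iff d_def[symmetric]
    proof
      fix i
      show "cdf (\<mu> i) (r $ i) = 1 - fst (c - s, \<chi> i. 1 - cdf (\<mu> i) (r $ i + d)) - snd (c - s, \<chi> i. 1 - cdf (\<mu> i) (r $ i + d)) $ i \<and>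
        cdf (\<mu> i) (r $ i + d) = 1 - snd (c - s, \<chi> i. 1 - cdf (\<mu> i) (r $ i + d)) $ i"
        using fo[of i] by simp
    qed
    ultimately show ?case using c m.cdf_bounded_prob by (simp add: scaled_closed_Delta_iff s_def)
  next
    case (2 \<beta>)
    then have snd: "snd \<beta> = (\<chi> i. 1 - cdf (\<mu> i) (r $ i + d))"
      by (simp add: corresponds_iff d_def vec_eq_iff)
    have "fst \<beta> = c - s" using 2 c unfolding s_def by (simp add: scaled_closed_Delta_iff snd)
    then show ?case using snd by (simp add: prod_eq_iff)
  qed
qed

text \<open>If \<beta>_0 = 0, F_i takes equal values at r_i and r_i + (\<xi> -
  \<open>total r\<close>). Some \<beta>_i lies in (0,1), and there injectivity excludes a positive
  width.\<close>

lemma corresponds_boundary: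
  assumes c: "0 < c" and \<beta>: "\<beta> \<in> scaled_closed_Delta c" "fst \<beta> = 0" "\<And>i. snd \<beta> $ i < 1"
    and "corresponds \<mu> \<xi> \<beta> r"
  shows "\<xi> \<le> total r"
proof (rule ccontr)
  assume less: "\<not> \<xi> \<le> total r"
  have "snd \<beta> $ i \<le> 0" for i
  proof (rule ccontr)
    assume "\<not> snd \<beta> $ i \<le> 0"
    then have "r $ i = r $ i + (\<xi> - total r)"
      using m.cdf_inj[of i "r $ i" "r $ i + (\<xi> - total r)"] assms(5) \<beta>(2) \<beta>(3)[of i]
      unfolding corresponds_iff by simp
    then show False using less by simp
  qed
  then have "total (snd \<beta>) \<le> 0" by (intro sum_nonpos) auto
  then show False using \<beta> c by (simp add: scaled_closed_Delta_iff)
qed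

text \<open>For \<beta>_0 > 0 both saddle bounds apply, so the objective equals \<xi> +
  (\<open>excess \<xi> r\<close> - c d) / \<beta>_0, and each minimality means
  \<open>excess \<xi> r\<close> = c d. For \<beta>_0 = 0 the width is 0 and both points are
  minimizers.\<close>

lemma conv_minimizer_iff_dual_minimizer:
  assumes t: "0 \<le> t" "t < 1" and \<xi>: "dual_bound_inv \<mu> (1 - t) = ereal \<xi>"
    and \<beta>: "\<beta> \<in> scaled_closed_Delta (1 - t)" "\<And>i. snd \<beta> $ i < 1"
    and r: "total r \<le> \<xi>" and corr: "corresponds \<mu> \<xi> \<beta> r"
  shows "\<beta> \<in> conv_minimizers \<mu> t \<longleftrightarrow> r \<in> dual_minimizers \<mu> \<xi>"
proof -
  define c where "c = 1 - t"
  define d where "d = \<xi> - total r"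
  have c: "0 < c" "c \<le> 1" using t by (auto simp: c_def)
  note b = \<beta>(1)[folded c_def, unfolded scaled_closed_Delta_iff[OF c(1)]]
  have F: "cdf (\<mu> i) (r $ i) = 1 - fst \<beta> - snd \<beta> $ i" "cdf (\<mu> i) (r $ i + d) = 1 - snd \<beta> $ i" for i
    using corr unfolding corresponds_iff d_def by auto
  show ?thesis
  proof (cases "fst \<beta> = 0")
    case True
    have tr: "total r = \<xi>" using corresponds_boundary[OF _ \<beta>(1) True \<beta>(2) corr] r t by simp
    have "(\<Sum>i\<in>UNIV. 1 - cdf (\<mu> i) (r $ i)) = c" using F(1) b True by simp
    then have dual: "r \<in> dual_minimizers \<mu> \<xi>" using tr \<xi> by (simp add: dual_minimizers_iff c_def)
    \<comment> \<open>Only an inequality, because at level 1 the point r_i may lie to the right of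
      the quantile. The reverse bound is recovered for the sum.\<close>
    have qm: "conv_term \<mu> \<beta> i \<le> ereal (r $ i)" "conv_term \<mu> \<beta> i \<noteq> -\<infinity>" for i
    proof -
      have pos: "0 < 1 - snd \<beta> $ i" using \<beta>(2)[of i] by simp
      have eq: "conv_term \<mu> \<beta> i = qminus (\<mu> i) (1 - snd \<beta> $ i)" using True by (simp add: conv_term_def)
      show "conv_term \<mu> \<beta> i \<le> ereal (r $ i)"
        unfolding eq m.qminus_le_iff[OF pos] F(1) using True by simp
      show "conv_term \<mu> \<beta> i \<noteq> -\<infinity>" unfolding eq by (rule m.qminus_neq_MInf[OF pos])
    qed
    then have defd: "conv_defined \<mu> \<beta>" using qm True \<beta>(2) unfolding conv_defined_def by auto
    have "conv_obj \<mu> \<beta> \<le> (\<Sum>i\<in>UNIV. ereal (r $ i))" unfolding conv_obj_def by (intro sum_mono qm)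
    then have "conv_obj \<mu> \<beta> \<le> ereal \<xi>" using tr by simp
    moreover have "ereal \<xi> \<le> conv_obj \<mu> \<beta>"
      using dual_bound_inv_le_conv_obj[of c \<beta>] c \<beta>(1) defd \<xi> by (simp add: c_def)
    ultimately have "\<beta> \<in> conv_minimizers \<mu> t" using t \<xi> \<beta>(1) defd by (simp add: conv_minimizers_iff)
    then show ?thesis using dual by simp
  next
    case False
    then have b0: "0 < fst \<beta>" using b by simp
    have le: "snd \<beta> $ i + fst \<beta> \<le> 1" for i using simplex_le[of \<beta> c i] b c by auto
    have "d \<noteq> 0" using F[of undefined] b0 by auto
    then have d: "0 < d" using r by (simp add: d_def)
    have R: "rvar (snd \<beta> $ i) (fst \<beta>) (\<mu> i) = ereal (m.saddle i (snd \<beta> $ i) (fst \<beta>) (r $ i) (r $ i + d) / fst \<beta>)" for i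
      using d b b0 le[of i] F[of i] by (intro antisym m.rvar_le_saddle m.saddle_le_rvar) auto
    have defd: "conv_defined \<mu> \<beta>"
      unfolding conv_defined_def
    proof (intro conjI impI allI)
      \<comment> \<open>Here \<beta>_i = 0, so F_i(r_i) = 0 and F_i(r_i + d) = 1: the support is
        bounded.\<close>
      fix i assume "fst \<beta> = 1"
      then have "snd \<beta> $ i = 0" using le[of i] b by (auto intro: antisym)
      then show "integrable (\<mu> i) (\<lambda>y. y)"
        using F[of i] \<open>fst \<beta> = 1\<close> by (intro m.integrable_bounded_support[of i "r $ i" "r $ i + d"]) auto
    qed (use False in \<open>auto simp: conv_term_def R\<close>)
    have "conv_obj \<mu> \<beta> = ereal ((\<Sum>i\<in>UNIV. m.saddle i (snd \<beta> $ i) (fst \<beta>) (r $ i) (r $ i + d)) / fst \<beta>)"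
      unfolding conv_obj_def conv_term_def R using False by (simp add: sum_divide_distrib)
    also have "\<dots> = ereal ((fst \<beta> * \<xi> + (excess \<xi> r - c * d)) / fst \<beta>)"
      using sum_saddle_eq[of r \<xi> \<beta> c] r b unfolding d_def by simp
    finally have "conv_obj \<mu> \<beta> = ereal \<xi> \<longleftrightarrow> excess \<xi> r = c * d" using b0 by (simp add: divide_eq_eq mult.commute)
    then show ?thesis
      using t \<xi> \<beta>(1) defd d r by (simp add: conv_minimizers_iff dual_minimizers_iff[OF \<xi>] c_def d_def)
  qed
qed

lemma conv_minimizer_terms:
  assumes t: "0 \<le> t" "t < 1" and \<xi>: "dual_bound_inv \<mu> (1 - t) = ereal \<xi>"
    and \<beta>: "\<beta> \<in> conv_minimizers \<mu> t"
  obtains \<rho> :: "real ^ 'n" where "\<And>i. conv_term \<mu> \<beta> i = ereal (\<rho> $ i)" "total \<rho> = \<xi>"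
proof -
  have obj: "(\<Sum>i\<in>UNIV. conv_term \<mu> \<beta> i) = ereal \<xi>"
    using \<beta> unfolding conv_minimizers_iff[OF t \<xi>] conv_obj_def by simp
  then have "\<bar>\<Sum>i\<in>UNIV. conv_term \<mu> \<beta> i\<bar> \<noteq> \<infinity>" by simp
  then have fin: "\<bar>conv_term \<mu> \<beta> i\<bar> \<noteq> \<infinity>" for i unfolding sum_Inf by auto
  define \<rho> :: "real ^ 'n" where "\<rho> = (\<chi> i. real_of_ereal (conv_term \<mu> \<beta> i))"
  have \<rho>: "conv_term \<mu> \<beta> i = ereal (\<rho> $ i)" for i
    using fin[of i] unfolding \<rho>_def by (simp add: ereal_real)
  moreover have "total \<rho> = \<xi>" using obj unfolding \<rho> by simp
  ultimately show ?thesis by (rule that)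
qed

text \<open>The vector of quantiles corresponds to \<beta>. Any other corresponding minimizer
  dominates it coordinatewise and has the same total \<xi>, hence equals it.\<close>

lemma boundary_conv_minimizer:
  assumes t: "0 \<le> t" "t < 1" and \<xi>: "dual_bound_inv \<mu> (1 - t) = ereal \<xi>"
    and \<beta>: "\<beta> \<in> conv_minimizers \<mu> t" and b0: "fst \<beta> = 0"
  shows "\<exists>!r. r \<in> dual_minimizers \<mu> \<xi> \<and> corresponds \<mu> \<xi> \<beta> r"
proof -
  have sc: "\<beta> \<in> scaled_closed_Delta (1 - t)" and lt1: "snd \<beta> $ i < 1" for i
    using \<beta> b0 unfolding conv_minimizers_iff[OF t \<xi>] conv_defined_def by auto
  have b: "\<And>i. 0 \<le> snd \<beta> $ i" "total (snd \<beta>) = 1 - t"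
    using sc b0 t by (auto simp: scaled_closed_Delta_iff)
  obtain \<rho> :: "real ^ 'n" where \<rho>: "\<And>i. conv_term \<mu> \<beta> i = ereal (\<rho> $ i)" "total \<rho> = \<xi>"
    using conv_minimizer_terms[OF t \<xi> \<beta>] by blast
  then have q: "qminus (\<mu> i) (1 - snd \<beta> $ i) = ereal (\<rho> $ i)" for i
    using b0 by (metis conv_term_def)
  then have F: "cdf (\<mu> i) (\<rho> $ i) = 1 - snd \<beta> $ i" for i
    using m.cdf_of_qminus[of i "1 - snd \<beta> $ i" "\<rho> $ i"] lt1[of i] b(1)[of i] by simp
  show ?thesis
  proof (rule ex1I[of _ \<rho>])
    show "\<rho> \<in> dual_minimizers \<mu> \<xi> \<and> corresponds \<mu> \<xi> \<beta> \<rho>"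
      using F \<rho>(2) b b0 by (simp add: dual_minimizers_iff[OF \<xi>] corresponds_iff)
    fix r assume r: "r \<in> dual_minimizers \<mu> \<xi> \<and> corresponds \<mu> \<xi> \<beta> r"
    then have tr: "total r = \<xi>"
      using corresponds_boundary[OF _ sc b0 lt1, of \<xi> r] t by (simp add: dual_minimizers_iff[OF \<xi>])
    have "\<rho> $ i \<le> r $ i" for i
      using m.qminus_le_iff[of "1 - snd \<beta> $ i" i "r $ i"] q[of i] r lt1[of i] b0 by (simp add: corresponds_iff)
    then have "\<rho> $ i = r $ i" for i
      using sum_mono_inv[of "\<lambda>i. \<rho> $ i" UNIV "\<lambda>i. r $ i" i] tr \<rho>(2) by simp
    then show "r = \<rho>" by (simp add: vec_eq_iff)
  qed
qed

text \<open>The points r_i are given at the lower levels, where \<open>saddle_le_rvar\<close> bounds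
  each saddle value by \<beta>_0 times its summand. Optimality of both values makes the summed
  inequality an equality, hence every single one.\<close>

lemma interior_conv_minimizer:
  assumes t: "0 \<le> t" "t < 1" and \<xi>: "dual_bound_inv \<mu> (1 - t) = ereal \<xi>"
    and \<beta>: "\<beta> \<in> conv_minimizers \<mu> t" and b0: "fst \<beta> \<noteq> 0"
    and F: "\<And>i. cdf (\<mu> i) (r $ i) = 1 - fst \<beta> - snd \<beta> $ i"
  shows "r \<in> dual_minimizers \<mu> \<xi> \<and> corresponds \<mu> \<xi> \<beta> r"
proof -
  define c where "c = 1 - t"
  have c: "0 < c" "c \<le> 1" using t by (auto simp: c_def)
  have b: "0 < fst \<beta>" "\<forall>i. 0 \<le> snd \<beta> $ i" "fst \<beta> + total (snd \<beta>) = c"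
    using \<beta> b0 t unfolding conv_minimizers_iff[OF t \<xi>] by (auto simp: scaled_closed_Delta_iff c_def)
  have le: "snd \<beta> $ i + fst \<beta> \<le> 1" for i using simplex_le[OF b(2,3), of i] c by simp
  obtain \<rho> :: "real ^ 'n" where \<rho>: "\<And>i. conv_term \<mu> \<beta> i = ereal (\<rho> $ i)" "total \<rho> = \<xi>"
    using conv_minimizer_terms[OF t \<xi> \<beta>] by blast
  then have R: "rvar (snd \<beta> $ i) (fst \<beta>) (\<mu> i) = ereal (\<rho> $ i)" for i
    using b0 by (metis conv_term_def)
  have "r $ i < \<rho> $ i" for i
    using m.less_rvar[of "snd \<beta> $ i" "fst \<beta>" i "r $ i"] b le[of i] F[of i] R[of i] by simp
  then have "total r < total \<rho>" by (intro sum_strict_mono) auto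
  then have tr: "total r < \<xi>" using \<rho> by simp
  define d where "d = \<xi> - total r"
  have d: "0 < d" using tr by (simp add: d_def)
  have S: "m.saddle i (snd \<beta> $ i) (fst \<beta>) (r $ i) y \<le> fst \<beta> * \<rho> $ i" if "r $ i \<le> y" for i y
    using m.saddle_le_rvar[OF that, where i=i and \<beta>="snd \<beta> $ i" and a="fst \<beta>"] b le[of i] F[of i] R[of i]
    by (simp add: divide_le_eq mult.commute)
  have sum: "(\<Sum>i\<in>UNIV. m.saddle i (snd \<beta> $ i) (fst \<beta>) (r $ i) (r $ i + d)) = fst \<beta> * \<xi> + (excess \<xi> r - c * d)"
    using sum_saddle_eq[of r \<xi> \<beta> c] tr b unfolding d_def by simp
  have rho_sum: "(\<Sum>i\<in>UNIV. fst \<beta> * \<rho> $ i) = fst \<beta> * \<xi>" using \<rho> by (simp add: sum_distrib_left[symmetric])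
  have "(\<Sum>i\<in>UNIV. m.saddle i (snd \<beta> $ i) (fst \<beta>) (r $ i) (r $ i + d)) \<le> fst \<beta> * \<xi>"
    unfolding rho_sum[symmetric] using d by (intro sum_mono S) auto
  then have ex: "excess \<xi> r = c * d"
    using excess_ge[OF \<xi> tr] sum unfolding c_def d_def by simp
  then have dual: "r \<in> dual_minimizers \<mu> \<xi>" using tr by (simp add: dual_minimizers_iff[OF \<xi>] c_def d_def)
  have eq: "m.saddle i (snd \<beta> $ i) (fst \<beta>) (r $ i) (r $ i + d) = fst \<beta> * \<rho> $ i" for i
    using sum_mono_inv[of "\<lambda>i. m.saddle i (snd \<beta> $ i) (fst \<beta>) (r $ i) (r $ i + d)" UNIV "\<lambda>i. fst \<beta> * \<rho> $ i" i]
      S d sum ex rho_sum by simp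
  \<comment> \<open>By \<open>S\<close> and \<open>eq\<close> the saddle function with left endpoint
    r_i is maximal at r_i + d, and its derivative there gives the upper level.\<close>
  have "cdf (\<mu> i) (r $ i + d) = 1 - snd \<beta> $ i" for i
    using d S[of i] eq[of i] by (intro m.cdf_eq_if_saddle_max[of "r $ i" _ i _ "fst \<beta>"]) auto
  then show ?thesis using dual F by (simp add: corresponds_iff d_def)
qed

end

text \<open>For t > 0 the levels 1 - \<beta>_0 - \<beta>_i are at least t and every \<beta>_i is
  below 1, which gives a bijection. For t = 0 a lower level may be 0 and need not be attained, and
  \<beta>_i = 1 with \<beta>_0 = 0 leaves the objective undefined; this is why the later clauses
  state the correspondence conditionally.\<close>

theorem theorem4:
  fixes \<mu> :: "'n::finite \<Rightarrow> real measure" and t :: real and x :: ereal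
  assumes "\<And>i. real_distribution (\<mu> i)"
    and "\<And>i. continuous_on UNIV (cdf (\<mu> i))"
    and "\<And>i. continuous_on {0<..1} (qminus (\<mu> i))"
    and "0 \<le> t" and "t < 1"
    and "x = dual_bound_inv \<mu> (1 - t)"
  shows "conv_inf \<mu> t = dual_bound_inv \<mu> (1 - t) \<and> dual_bound_inv \<mu> (1 - t) = x \<and>
    (0 < t \<longrightarrow> \<bar>x\<bar> \<noteq> \<infinity>) \<and>
    (\<forall>\<xi>. x = ereal \<xi> \<longrightarrow>
      (0 < t \<longrightarrow>
        (\<forall>\<beta>\<in>conv_minimizers \<mu> t. \<exists>!r. r \<in> dual_minimizers \<mu> \<xi> \<and> corresponds \<mu> \<xi> \<beta> r) \<and>
        (\<forall>r\<in>dual_minimizers \<mu> \<xi>. \<exists>!\<beta>. \<beta> \<in> conv_minimizers \<mu> t \<and> corresponds \<mu> \<xi> \<beta> r)) \<and>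
      (\<forall>\<beta>\<in>scaled_closed_Delta (1 - t). \<forall>r\<in>closure (Delta_below \<xi>).
        (\<forall>i. snd \<beta> $ i < 1) \<and> corresponds \<mu> \<xi> \<beta> r \<longrightarrow>
          (\<beta> \<in> conv_minimizers \<mu> t \<longleftrightarrow> r \<in> dual_minimizers \<mu> \<xi>)) \<and>
      (\<forall>\<beta>\<in>conv_minimizers \<mu> t.
        (\<forall>i. \<exists>y. measure (\<mu> i) {..y} = 1 - fst \<beta> - snd \<beta> $ i) \<longrightarrow>
          (\<exists>r\<in>dual_minimizers \<mu> \<xi>. corresponds \<mu> \<xi> \<beta> r)) \<and>
      (\<forall>r\<in>dual_minimizers \<mu> \<xi>.
        \<exists>!\<beta>. \<beta> \<in> scaled_closed_Delta (1 - t) \<and> corresponds \<mu> \<xi> \<beta> r))"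
proof -
  note t = assms(4,5)
  have "continuous_quantile_distribution (\<mu> i)" for i
    by (intro continuous_quantile_distribution.intro cdf_distribution.intro
      continuous_quantile_distribution_axioms.intro assms(1-3))
  then interpret continuous_quantile_family \<mu> by (rule continuous_quantile_family.intro)
  have finite_x: "0 < t \<longrightarrow> \<bar>x\<bar> \<noteq> \<infinity>"
    using dual_bound_inv_neq_PInf[of "1 - t"] dual_bound_inv_neq_MInf[of "1 - t"] t assms(6) by auto
  have "(0 < t \<longrightarrow>
        (\<forall>\<beta>\<in>conv_minimizers \<mu> t. \<exists>!r. r \<in> dual_minimizers \<mu> \<xi> \<and> corresponds \<mu> \<xi> \<beta> r) \<and>
        (\<forall>r\<in>dual_minimizers \<mu> \<xi>. \<exists>!\<beta>. \<beta> \<in> conv_minimizers \<mu> t \<and> corresponds \<mu> \<xi> \<beta> r)) \<and>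
      (\<forall>\<beta>\<in>scaled_closed_Delta (1 - t). \<forall>r\<in>closure (Delta_below \<xi>).
        (\<forall>i. snd \<beta> $ i < 1) \<and> corresponds \<mu> \<xi> \<beta> r \<longrightarrow>
          (\<beta> \<in> conv_minimizers \<mu> t \<longleftrightarrow> r \<in> dual_minimizers \<mu> \<xi>)) \<and>
      (\<forall>\<beta>\<in>conv_minimizers \<mu> t.
        (\<forall>i. \<exists>y. measure (\<mu> i) {..y} = 1 - fst \<beta> - snd \<beta> $ i) \<longrightarrow>
          (\<exists>r\<in>dual_minimizers \<mu> \<xi>. corresponds \<mu> \<xi> \<beta> r)) \<and>
      (\<forall>r\<in>dual_minimizers \<mu> \<xi>.
        \<exists>!\<beta>. \<beta> \<in> scaled_closed_Delta (1 - t) \<and> corresponds \<mu> \<xi> \<beta> r)"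
    (is "(0 < t \<longrightarrow> ?A \<and> ?B) \<and> ?C \<and> ?D \<and> ?E") if "x = ereal \<xi>" for \<xi>
  proof -
    have \<xi>: "dual_bound_inv \<mu> (1 - t) = ereal \<xi>" using that assms(6) by simp
    have C: ?C
      using conv_minimizer_iff_dual_minimizer[OF t \<xi>] by (auto simp: closure_Delta_below)
    have E: ?E using ex1_corresponding_conv_point[OF _ \<xi>] t by simp
    have D: ?D
    proof (intro ballI impI)
      fix \<beta> assume \<beta>: "\<beta> \<in> conv_minimizers \<mu> t"
        and "\<forall>i. \<exists>y. measure (\<mu> i) {..y} = 1 - fst \<beta> - snd \<beta> $ i"
      then obtain y where y: "\<And>i. cdf (\<mu> i) (y i) = 1 - fst \<beta> - snd \<beta> $ i" unfolding cdf_def by metis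
      show "\<exists>r\<in>dual_minimizers \<mu> \<xi>. corresponds \<mu> \<xi> \<beta> r"
      proof (cases "fst \<beta> = 0")
        case True
        then show ?thesis using boundary_conv_minimizer[OF t \<xi> \<beta>] by blast
      next
        case False
        then show ?thesis using interior_conv_minimizer[OF t \<xi> \<beta>, of "\<chi> i. y i"] y by auto
      qed
    qed
    have A: ?A if "0 < t"
    proof
      fix \<beta> assume \<beta>: "\<beta> \<in> conv_minimizers \<mu> t"
      show "\<exists>!r. r \<in> dual_minimizers \<mu> \<xi> \<and> corresponds \<mu> \<xi> \<beta> r"
      proof (cases "fst \<beta> = 0")
        case True
        then show ?thesis using boundary_conv_minimizer[OF t \<xi> \<beta>] by blast
      next
        case False
        have b: "0 < fst \<beta>" "\<forall>i. 0 \<le> snd \<beta> $ i" "fst \<beta> + total (snd \<beta>) = 1 - t"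
          using \<beta> False t unfolding conv_minimizers_iff[OF t \<xi>] by (auto simp: scaled_closed_Delta_iff)
        have v: "0 < 1 - fst \<beta> - snd \<beta> $ i" "1 - fst \<beta> - snd \<beta> $ i < 1" for i
          using simplex_le[OF b(2,3), of i] b(1) b(2)[rule_format, of i] that by linarith+
        have "\<exists>y. cdf (\<mu> i) y = 1 - fst \<beta> - snd \<beta> $ i" for i
          using m.ex_cdf_eq[OF v[of i], of i] by blast
        then obtain y where y: "\<And>i. cdf (\<mu> i) (y i) = 1 - fst \<beta> - snd \<beta> $ i" by metis
        show ?thesis
        proof (rule ex1I[of _ "\<chi> i. y i"])
          show "(\<chi> i. y i) \<in> dual_minimizers \<mu> \<xi> \<and> corresponds \<mu> \<xi> \<beta> (\<chi> i. y i)"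
            using interior_conv_minimizer[OF t \<xi> \<beta> False, of "\<chi> i. y i"] y by simp
          fix r assume "r \<in> dual_minimizers \<mu> \<xi> \<and> corresponds \<mu> \<xi> \<beta> r"
          then have "cdf (\<mu> i) (r $ i) = cdf (\<mu> i) (y i)" for i using y by (simp add: corresponds_iff)
          then have "r $ i = y i" for i using m.cdf_inj[of i "r $ i" "y i"] y[of i] v[of i] by simp
          then show "r = (\<chi> i. y i)" by (simp add: vec_eq_iff)
        qed
      qed
    qed
    have B: ?B if "0 < t"
    proof
      fix r assume r: "r \<in> dual_minimizers \<mu> \<xi>"
      \<comment> \<open>For a dual minimizer r every corresponding point of the closed simplex is
        itself a minimizer, so existence and uniqueness transfer from \<open>E\<close>.\<close>
      have "\<beta> \<in> conv_minimizers \<mu> t \<and> corresponds \<mu> \<xi> \<beta> r \<longleftrightarrow>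
          \<beta> \<in> scaled_closed_Delta (1 - t) \<and> corresponds \<mu> \<xi> \<beta> r" for \<beta>
      proof -
        have "\<beta> \<in> conv_minimizers \<mu> t" if \<beta>: "\<beta> \<in> scaled_closed_Delta (1 - t)" "corresponds \<mu> \<xi> \<beta> r"
        proof -
          have "snd \<beta> $ i < 1" for i
            using simplex_le[of \<beta> "1 - t" i] \<beta>(1) t \<open>0 < t\<close> by (simp add: scaled_closed_Delta_iff)
          then show ?thesis
            using conv_minimizer_iff_dual_minimizer[OF t \<xi> \<beta>(1) _ _ \<beta>(2)] r
            by (simp add: dual_minimizers_iff[OF \<xi>])
        qed
        then show ?thesis by (auto simp: conv_minimizers_iff[OF t \<xi>])
      qed
      then show "\<exists>!\<beta>. \<beta> \<in> conv_minimizers \<mu> t \<and> corresponds \<mu> \<xi> \<beta> r"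
        using E r by simp
    qed
    show ?thesis using A B C D E by blast
  qed
  then show ?thesis using conv_inf_eq_dual_bound_inv[OF t] assms(6) finite_x by blast
qed

end
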